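(* Let $d,k\in\mathbb{N}$ and let $W$ be a real symmetric positive definite $k\times k$ matrix with simple eigenvalues (i.e. $k$ distinct eigenvalues). Let $(\omega_n)_{n\in\mathbb{Z}^d}$ be independent, identically distributed real random variables whose common distribution $\mu$ is absolutely continuous with a bounded, compactly supported density $\rho$. On $\ell^2(\mathbb{Z}^d;\mathbb{C}^k)$ define $$(H^A_\omega\phi)(n)=(h_0\phi)(n)+\omega_n W\phi(n),\qquad n\in\mathbb{Z}^d,$$ where $(h_0\phi)(n)=\sum_{m\in\mathbb{Z}^d:\,|m-n|=1}\phi(m)$ is the discrete Laplacian acting componentwise. Then for almost every $\omega$, all eigenvalues of $H^A_\omega$ are simple (have multiplicity one).
   Context: $|m-n|=1$ means $m$ and $n$ are nearest neighbours in $\mathbb{Z}^d$. "Almost every $\omega$" refers to the product measure $\bigotimes_{n\in\mathbb{Z}^d}\mu$. *)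

theory Defs
  imports "HOL-Probability.Probability"
begin

definition lattice :: "nat \<Rightarrow> (nat \<Rightarrow> int) set" where
  "lattice d = {n. \<forall>i\<ge>d. n i = 0}"

definition nbr :: "nat \<Rightarrow> (nat \<Rightarrow> int) \<Rightarrow> (nat \<Rightarrow> int) \<Rightarrow> bool" where
  "nbr d m n \<longleftrightarrow> (\<Sum>i<d. \<bar>m i - n i\<bar>) = 1"

definition cmat_vec :: "real^'k^'k \<Rightarrow> complex^'k \<Rightarrow> complex^'k" where
  "cmat_vec W v = (\<chi> i. \<Sum>j\<in>UNIV. complex_of_real (W $ i $ j) * v $ j)"

definition H_A :: "nat \<Rightarrow> real^'k^'k \<Rightarrow> ((nat \<Rightarrow> int) \<Rightarrow> real)
    \<Rightarrow> ((nat \<Rightarrow> int) \<Rightarrow> complex^'k) \<Rightarrow> (nat \<Rightarrow> int) \<Rightarrow> complex^'k" where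
  "H_A d W \<omega> \<phi> n =
     (\<Sum>m\<in>{m\<in>lattice d. nbr d m n}. \<phi> m) + complex_of_real (\<omega> n) *s cmat_vec W (\<phi> n)"

definition l2 :: "nat \<Rightarrow> ((nat \<Rightarrow> int) \<Rightarrow> complex^'k) set" where
  "l2 d = {\<phi>. (\<lambda>n. (norm (\<phi> n))^2) summable_on lattice d}"

definition eigvec :: "nat \<Rightarrow> real^'k^'k \<Rightarrow> ((nat \<Rightarrow> int) \<Rightarrow> real) \<Rightarrow> complex
    \<Rightarrow> ((nat \<Rightarrow> int) \<Rightarrow> complex^'k) \<Rightarrow> bool" where
  "eigvec d W \<omega> E \<phi> \<longleftrightarrow> \<phi> \<in> l2 d \<and> (\<exists>n\<in>lattice d. \<phi> n \<noteq> 0) \<and>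
      (\<forall>n\<in>lattice d. H_A d W \<omega> \<phi> n = E *s \<phi> n)"

definition is_eigenvalue :: "nat \<Rightarrow> real^'k^'k \<Rightarrow> ((nat \<Rightarrow> int) \<Rightarrow> real) \<Rightarrow> complex \<Rightarrow> bool" where
  "is_eigenvalue d W \<omega> E \<longleftrightarrow> (\<exists>\<phi>. eigvec d W \<omega> E \<phi>)"

definition simple_eigenvalue :: "nat \<Rightarrow> real^'k^'k \<Rightarrow> ((nat \<Rightarrow> int) \<Rightarrow> real) \<Rightarrow> complex \<Rightarrow> bool" where
  "simple_eigenvalue d W \<omega> E \<longleftrightarrow>
     (\<forall>\<phi> \<psi>. eigvec d W \<omega> E \<phi> \<and> eigvec d W \<omega> E \<psi> \<longrightarrow>
        (\<exists>c::complex. \<forall>n\<in>lattice d. \<psi> n = c *s \<phi> n))"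

end

theory Submission
  imports Defs
begin

text \<open>
  Let \<open>u\<close> run over the eigenvectors of \<open>W\<close>. The components \<open>u \<bullet> \<phi>(n)\<close> decouple the operator into
  scalar operators \<open>h\<^sub>w = h\<^sub>0 + w \<omega>\<close>, one for each eigenvalue \<open>w\<close> of \<open>W\<close>. Suppose that only
  \<open>\<omega> n\<close> varies, with values \<open>x\<close>, \<open>y\<close>, and that \<open>h\<^sub>w f = E f\<close>, \<open>h\<^sub>w f' = E' f'\<close> for these values. As
  \<open>h\<^sub>0\<close> is symmetric, \<open>(E - E') \<langle>f', f\<rangle> = w (x - y) f'(n) f(n)\<close>. If two weights \<open>w1\<close>, \<open>w2\<close> share the
  energies \<open>E\<close> and \<open>E'\<close>, with eigenfunctions \<open>f, g\<close> and \<open>f', g'\<close> where \<open>g(n) = g'(n) = 1\<close>, division gives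
  \<open>w2 \<langle>f', f\<rangle> = w1 f'(n) f(n) \<langle>g', g\<rangle>\<close>. Since \<open>\<ell>\<^sup>2\<close> is separable, for all but countably many values
  of \<open>\<omega> n\<close> the pair \<open>(f', g')\<close> can be made to converge weakly to \<open>(f, g)\<close>, so that
  \<open>w2 \<bar>g(n)\<bar>\<^sup>2 \<parallel>f\<parallel>\<^sup>2 = w1 \<bar>f(n)\<bar>\<^sup>2 \<parallel>g\<parallel>\<^sup>2\<close>. As \<open>\<mu>\<close> has no atoms, this holds almost surely at every site
  \<open>n\<close>. Summation over \<open>n\<close> gives \<open>w1 = w2\<close>, so distinct weights have no common eigenvalue. For
  \<open>w1 = w2\<close>, an eigenfunction vanishing at a site where another one does not must vanish
  identically, so the eigenvalues of each \<open>h\<^sub>w\<close> are simple.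
\<close>

section \<open>Real square-summable functions\<close>

lemma infsum_diff_real:
  fixes f g :: "'a \<Rightarrow> real"
  assumes "f summable_on A" "g summable_on A"
  shows "(\<Sum>\<^sub>\<infinity>x\<in>A. f x - g x) = infsum f A - infsum g A"
  using infsum_add[of f A "\<lambda>x. - g x"] summable_on_uminus[of g A] assms
  by (simp add: infsum_uminus)

definition ell2 :: "'a set \<Rightarrow> ('a \<Rightarrow> real) \<Rightarrow> bool" where
  "ell2 L f \<longleftrightarrow> (\<lambda>v. (f v)\<^sup>2) summable_on L"

definition inner_on :: "'a set \<Rightarrow> ('a \<Rightarrow> real) \<Rightarrow> ('a \<Rightarrow> real) \<Rightarrow> real" where
  "inner_on L f g = (\<Sum>\<^sub>\<infinity>v\<in>L. f v * g v)"

lemma ell2_mult_summable: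
  assumes "ell2 L f" "ell2 L g"
  shows "(\<lambda>v. f v * g v) summable_on L"
proof -
  have "(\<lambda>v. (f v)\<^sup>2 + (g v)\<^sup>2) summable_on L"
    using assms unfolding ell2_def by (intro summable_on_add)
  then have "(\<lambda>v. norm (f v * g v)) summable_on L"
  proof (rule summable_on_comparison_test)
    fix v
    have "2 * (\<bar>f v\<bar> * \<bar>g v\<bar>) \<le> (f v)\<^sup>2 + (g v)\<^sup>2"
      using sum_squares_bound[of "\<bar>f v\<bar>" "\<bar>g v\<bar>"] by simp
    moreover have "0 \<le> \<bar>f v\<bar> * \<bar>g v\<bar>" by simp
    ultimately show "norm (f v * g v) \<le> (f v)\<^sup>2 + (g v)\<^sup>2"
      unfolding real_norm_def abs_mult by linarith
  qed simp
  then show ?thesis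
    by (rule summable_on_iff_abs_summable_on_real[THEN iffD2])
qed

lemma ell2_add: "ell2 L f \<Longrightarrow> ell2 L g \<Longrightarrow> ell2 L (\<lambda>v. f v + g v)"
proof -
  assume fg: "ell2 L f" "ell2 L g"
  then have "(\<lambda>v. ((f v)\<^sup>2 + (g v)\<^sup>2) + 2 * (f v * g v)) summable_on L"
    unfolding ell2_def
    by (intro summable_on_add summable_on_cmult_right ell2_mult_summable) (auto simp: ell2_def)
  then show ?thesis
    unfolding ell2_def by (simp add: power2_sum algebra_simps)
qed

lemma ell2_cmult: "ell2 L f \<Longrightarrow> ell2 L (\<lambda>v. c * f v)"
  unfolding ell2_def power_mult_distrib by (rule summable_on_cmult_right)

lemma ell2_diff: "ell2 L f \<Longrightarrow> ell2 L g \<Longrightarrow> ell2 L (\<lambda>v. f v - g v)"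
  using ell2_add[of L f "\<lambda>v. -1 * g v"] ell2_cmult[of L g "-1"] by simp

lemma inner_on_cong:
  "(\<And>v. v \<in> L \<Longrightarrow> f v = f' v) \<Longrightarrow> (\<And>v. v \<in> L \<Longrightarrow> g v = g' v) \<Longrightarrow> inner_on L f g = inner_on L f' g'"
  unfolding inner_on_def by (rule infsum_cong) simp

lemma inner_on_self: "inner_on L f f = (\<Sum>\<^sub>\<infinity>v\<in>L. (f v)\<^sup>2)"
  unfolding inner_on_def by (simp add: power2_eq_square)

lemma inner_on_self_nonneg: "0 \<le> inner_on L f f"
  unfolding inner_on_self by (rule infsum_nonneg) simp

lemma sum_le_inner_on_self:
  assumes "ell2 L f" "finite F" "F \<subseteq> L"
  shows "(\<Sum>v\<in>F. (f v)\<^sup>2) \<le> inner_on L f f"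
  unfolding inner_on_self using assms by (intro finite_sum_le_infsum) (auto simp: ell2_def)

lemma inner_on_self_pos:
  assumes "ell2 L f" "v \<in> L" "f v \<noteq> 0"
  shows "0 < inner_on L f f"
proof -
  have "(\<Sum>v\<in>{v}. (f v)\<^sup>2) \<le> inner_on L f f"
    by (rule sum_le_inner_on_self) (use assms in auto)
  then have "(f v)\<^sup>2 \<le> inner_on L f f" by simp
  moreover have "0 < (f v)\<^sup>2" using assms by simp
  ultimately show ?thesis by linarith
qed

lemma inner_on_cmult_self: "inner_on L (\<lambda>v. c * f v) (\<lambda>v. c * f v) = c\<^sup>2 * inner_on L f f"
  unfolding inner_on_self power_mult_distrib by (simp add: infsum_cmult_right')

text \<open>Turns membership in a ball of \<open>ell2\<close> into conditions on finitely many
  coordinates each, which are closed for pointwise convergence.\<close>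

lemma ell2_iff_bounded_sums:
  "ell2 L f \<and> inner_on L f f \<le> B \<longleftrightarrow> (\<forall>F. finite F \<and> F \<subseteq> L \<longrightarrow> (\<Sum>v\<in>F. (f v)\<^sup>2) \<le> B)"
proof
  assume "ell2 L f \<and> inner_on L f f \<le> B"
  then show "\<forall>F. finite F \<and> F \<subseteq> L \<longrightarrow> (\<Sum>v\<in>F. (f v)\<^sup>2) \<le> B"
    by (metis order_trans sum_le_inner_on_self)
next
  assume *: "\<forall>F. finite F \<and> F \<subseteq> L \<longrightarrow> (\<Sum>v\<in>F. (f v)\<^sup>2) \<le> B"
  have "ell2 L f"
    unfolding ell2_def
    by (rule nonneg_bdd_above_summable_on) (use * in \<open>auto intro!: bdd_aboveI2\<close>)
  moreover from this have "inner_on L f f \<le> B"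
    unfolding inner_on_self ell2_def by (rule infsum_le_finite_sums) (use * in auto)
  ultimately show "ell2 L f \<and> inner_on L f f \<le> B" ..
qed

text \<open>A form of Young's inequality replaces Cauchy-Schwarz: for small \<open>\<delta>\<close>,
  a merely bounded \<open>f\<close> contributes little once the squared norm of \<open>g\<close> is
  small compared with \<open>\<delta>\<close>.\<close>

lemma abs_inner_on_le:
  assumes f: "ell2 L f" and g: "ell2 L g" and "\<delta> > 0"
  shows "\<bar>inner_on L f g\<bar> \<le> \<delta> * inner_on L f f + inner_on L g g / \<delta>"
proof -
  have s: "(\<lambda>v. norm (f v * g v)) summable_on L"
    by (rule summable_on_iff_abs_summable_on_real[THEN iffD1, OF ell2_mult_summable[OF f g]])
  have s': "(\<lambda>v. \<delta> * (f v)\<^sup>2 + inverse \<delta> * (g v)\<^sup>2) summable_on L"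
    using f g unfolding ell2_def
    by (intro summable_on_add) (rule summable_on_cmult_right, assumption)+
  have "norm (inner_on L f g) \<le> (\<Sum>\<^sub>\<infinity>v\<in>L. norm (f v * g v))"
    unfolding inner_on_def by (rule norm_infsum_bound[OF s])
  also have "\<dots> \<le> (\<Sum>\<^sub>\<infinity>v\<in>L. \<delta> * (f v)\<^sup>2 + inverse \<delta> * (g v)\<^sup>2)"
  proof (rule infsum_mono[OF s s'])
    fix v
    let ?a = "\<delta> * \<bar>f v\<bar>" and ?b = "\<bar>g v\<bar>"
    have "2 * (?a * ?b) \<le> ?a\<^sup>2 + ?b\<^sup>2"
      using sum_squares_bound[of ?a ?b] by simp
    moreover have "0 \<le> ?a * ?b" using \<open>\<delta> > 0\<close> by simp
    ultimately have "?a * ?b \<le> ?a\<^sup>2 + ?b\<^sup>2" by linarith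
    then have "inverse \<delta> * (?a * ?b) \<le> inverse \<delta> * (?a\<^sup>2 + ?b\<^sup>2)"
      by (rule mult_left_mono) (use \<open>\<delta> > 0\<close> in simp)
    then show "norm (f v * g v) \<le> \<delta> * (f v)\<^sup>2 + inverse \<delta> * (g v)\<^sup>2"
      using \<open>\<delta> > 0\<close> by (simp add: abs_mult field_simps power2_eq_square)
  qed
  also have "\<dots> = \<delta> * inner_on L f f + inner_on L g g / \<delta>"
    unfolding inner_on_self
    using f g by (subst infsum_add) (auto simp: ell2_def infsum_cmult_right' divide_inverse_commute
        intro!: summable_on_cmult_right)
  finally show ?thesis by simp
qed

lemma inner_on_split:
  assumes f: "ell2 L f" and g: "ell2 L g" and F: "finite F" "F \<subseteq> L"
  shows "inner_on L f g = (\<Sum>v\<in>F. f v * g v) + inner_on (L - F) f g"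
proof -
  have s: "(\<lambda>v. f v * g v) summable_on L" by (rule ell2_mult_summable[OF f g])
  have "(\<Sum>\<^sub>\<infinity>v\<in>F \<union> (L - F). f v * g v) = (\<Sum>\<^sub>\<infinity>v\<in>F. f v * g v) + (\<Sum>\<^sub>\<infinity>v\<in>L - F. f v * g v)"
    by (rule infsum_Un_disjoint) (use F s in \<open>auto intro: summable_on_subset_banach\<close>)
  moreover have "F \<union> (L - F) = L" using F by auto
  ultimately show ?thesis unfolding inner_on_def using F by simp
qed

lemma inner_on_self_mono:
  assumes "ell2 L f" "K \<subseteq> L" shows "inner_on K f f \<le> inner_on L f f"
  unfolding inner_on_self using assms
  by (intro infsum_mono2) (auto simp: ell2_def intro: summable_on_subset_banach)

lemma ell2_subset: "ell2 L f \<Longrightarrow> K \<subseteq> L \<Longrightarrow> ell2 K f"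
  unfolding ell2_def by (rule summable_on_subset_banach)

text \<open>For norm-bounded sequences pointwise convergence implies weak convergence: a finite set
  \<open>F\<close> carries almost all of the norm of \<open>g\<close>. On it finitely many limits
  suffice, and off it \<open>abs_inner_on_le\<close> controls the rest.\<close>

lemma inner_on_tendsto:
  fixes f :: "nat \<Rightarrow> 'a \<Rightarrow> real"
  assumes f: "\<And>k. ell2 L (f k)" "\<And>k. inner_on L (f k) (f k) \<le> B" and g: "ell2 L g"
    and lim: "\<And>v. v \<in> L \<Longrightarrow> (\<lambda>k. f k v) \<longlonglongrightarrow> h v"
    and h: "ell2 L h"
  shows "(\<lambda>k. inner_on L (f k) g) \<longlonglongrightarrow> inner_on L h g"
proof -
  define f' where "f' k v = f k v - h v" for k v
  define C where "C = 2 * B + 2 * inner_on L h h"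
  have f': "ell2 L (f' k)" for k
    unfolding f'_def by (rule ell2_diff[OF f(1) h])
  have f'C: "inner_on L (f' k) (f' k) \<le> C" for k
  proof -
    have "inner_on L (f' k) (f' k) \<le> (\<Sum>\<^sub>\<infinity>v\<in>L. 2 * (f k v)\<^sup>2 + 2 * (h v)\<^sup>2)"
      unfolding inner_on_self
    proof (rule infsum_mono)
      show "(\<lambda>v. (f' k v)\<^sup>2) summable_on L" using f' unfolding ell2_def .
      show "(\<lambda>v. 2 * (f k v)\<^sup>2 + 2 * (h v)\<^sup>2) summable_on L"
        using f(1) h unfolding ell2_def by (intro summable_on_add summable_on_cmult_right)
      fix v
      have "0 \<le> (f k v + h v)\<^sup>2" by simp
      then show "(f' k v)\<^sup>2 \<le> 2 * (f k v)\<^sup>2 + 2 * (h v)\<^sup>2"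
        unfolding f'_def by (simp add: power2_eq_square algebra_simps)
    qed
    also have "\<dots> = 2 * inner_on L (f k) (f k) + 2 * inner_on L h h"
      unfolding inner_on_self using f(1) h
      by (subst infsum_add) (auto simp: ell2_def infsum_cmult_right' intro!: summable_on_cmult_right)
    also have "\<dots> \<le> C" unfolding C_def using f(2)[of k] by simp
    finally show ?thesis .
  qed
  have C0: "0 \<le> C" using f'C[of 0] inner_on_self_nonneg order_trans by blast
  have diff: "inner_on L (f k) g - inner_on L h g = inner_on L (f' k) g" for k
    unfolding inner_on_def f'_def left_diff_distrib
    using ell2_mult_summable[OF f(1) g] ell2_mult_summable[OF h g]
    by (subst infsum_diff_real) auto
  have "(\<lambda>k. inner_on L (f' k) g) \<longlonglongrightarrow> 0"
  proof (rule LIMSEQ_I)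
    fix e :: real assume "e > 0"
    \<comment> \<open>With this choice each of the three contributions below is at most
      \<open>e / 4\<close>; the \<open>C + 1\<close> keeps the denominator positive when
      \<open>C = 0\<close>.\<close>
    define \<delta> where "\<delta> = e / (4 * (C + 1))"
    have \<delta>: "\<delta> > 0" unfolding \<delta>_def using \<open>e > 0\<close> C0 by simp
    have "\<delta> * (C + 1) = e / 4" unfolding \<delta>_def using C0 by (simp add: field_simps)
    then have \<delta>C: "\<delta> * C \<le> e / 4" using \<delta> by (simp add: algebra_simps)
    obtain F where F: "finite F" "F \<subseteq> L"
      and Fe: "dist (\<Sum>v\<in>F. (g v)\<^sup>2) (\<Sum>\<^sub>\<infinity>v\<in>L. (g v)\<^sup>2) \<le> \<delta> * e / 4"
      using infsum_finite_approximation[of "\<lambda>v. (g v)\<^sup>2" L "\<delta> * e / 4"] g \<delta> \<open>e > 0\<close>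
      unfolding ell2_def by auto
    have tail: "inner_on (L - F) g g \<le> \<delta> * e / 4"
      using inner_on_split[OF g g F] Fe inner_on_self_nonneg[of "L - F" g]
      unfolding inner_on_self[of L] by (simp add: dist_real_def power2_eq_square)
    have "(\<lambda>k. \<Sum>v\<in>F. f' k v * g v) \<longlonglongrightarrow> (\<Sum>v\<in>F. 0 * g v)"
      unfolding f'_def using lim F by (intro tendsto_intros) (use lim in \<open>auto intro!: LIM_zero\<close>)
    then obtain k0 where k0: "\<And>k. k \<ge> k0 \<Longrightarrow> \<bar>\<Sum>v\<in>F. f' k v * g v\<bar> < e / 4"
      using LIMSEQ_D[of _ 0 "e / 4"] \<open>e > 0\<close> by fastforce
    show "\<exists>k0. \<forall>k\<ge>k0. norm (inner_on L (f' k) g - 0) < e"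
    proof (intro exI allI impI)
      fix k assume "k0 \<le> k"
      have "\<bar>inner_on (L - F) (f' k) g\<bar> \<le> \<delta> * inner_on (L - F) (f' k) (f' k) + inner_on (L - F) g g / \<delta>"
        by (rule abs_inner_on_le) (use f' g \<delta> in \<open>auto intro: ell2_subset\<close>)
      moreover have "\<delta> * inner_on (L - F) (f' k) (f' k) \<le> \<delta> * C"
        using inner_on_self_mono[OF f', of "L - F" k] f'C[of k] \<delta> by (intro mult_left_mono) auto
      moreover have "inner_on (L - F) g g / \<delta> \<le> e / 4"
        using tail \<delta> by (simp add: field_simps)
      ultimately show "norm (inner_on L (f' k) g - 0) < e"
        using k0[OF \<open>k0 \<le> k\<close>] \<delta>C \<open>e > 0\<close>
        unfolding inner_on_split[OF f' g F, of k] real_norm_def by linarith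
    qed
  qed
  then show ?thesis
    unfolding diff[symmetric] by (rule LIM_zero_cancel)
qed

section \<open>Topological preliminaries\<close>

text \<open>A basic open set that meets \<open>X\<close> in \<open>x\<close> alone determines
  \<open>x\<close>, so a countable basis leaves room for only countably many points.\<close>

lemma countable_if_all_isolated:
  fixes X :: "'a::second_countable_topology set"
  assumes "\<And>x. x \<in> X \<Longrightarrow> \<not> x islimpt X"
  shows "countable X"
proof -
  obtain B :: "'a set set" where B: "countable B" "topological_basis B"
    using ex_countable_basis by blast
  have "\<exists>b\<in>B. b \<inter> X = {x}" if "x \<in> X" for x
  proof -
    obtain U where U: "open U" "x \<in> U" "\<forall>y\<in>X. y \<in> U \<longrightarrow> y = x"
      using assms[OF \<open>x \<in> X\<close>] unfolding islimpt_def by blast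
    obtain b where "b \<in> B" "x \<in> b" "b \<subseteq> U"
      using topological_basisE[OF B(2) U(1,2)] by blast
    then show ?thesis using U \<open>x \<in> X\<close> by blast
  qed
  then obtain b where b: "\<And>x. x \<in> X \<Longrightarrow> b x \<in> B \<and> b x \<inter> X = {x}" by metis
  have "inj_on b X" by (rule inj_onI) (metis b singleton_inject)
  moreover have "b ` X \<subseteq> B" using b by blast
  ultimately show ?thesis
    by (meson B(1) countable_image_inj_on countable_subset)
qed

text \<open>Projection along a compact factor is a closed map. This lets the existential quantifier
  over \<open>E\<close>, \<open>f\<close>, \<open>g\<close> preserve closedness.\<close>

lemma closed_compact_projection':
  fixes T :: "('a::topological_space \<times> 'b::topological_space) set"
  assumes "compact K" "closed T"
  shows "closed {x. \<exists>y\<in>K. (x, y) \<in> T}"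
proof -
  have "closedin (prod_topology euclidean (top_of_set K)) (T \<inter> UNIV \<times> K)"
  proof -
    have "prod_topology euclidean (top_of_set K) = top_of_set (UNIV \<times> K :: ('a \<times> 'b) set)"
      by (metis prod_topology_subtopology_eu subtopology_UNIV)
    then show ?thesis
      using closedin_closed_Int[OF assms(2), of "UNIV \<times> K"] by (simp add: Int_commute)
  qed
  moreover have "closed_map (prod_topology euclidean (top_of_set K)) (euclidean :: 'a topology) fst"
    by (rule Abstract_Topological_Spaces.closed_map_fst)
      (use assms(1) in \<open>simp add: compact_space_subtopology\<close>)
  ultimately have "closed (fst ` (T \<inter> UNIV \<times> K))"
    unfolding closed_map_def by simp
  moreover have "fst ` (T \<inter> UNIV \<times> K) = {x. \<exists>y\<in>K. (x, y) \<in> T}"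
    by force
  ultimately show ?thesis by simp
qed

lemma compact_UNIV_PiE:
  fixes K :: "'a \<Rightarrow> 'b::topological_space set"
  assumes "\<And>i. compact (K i)"
  shows "compact (PiE UNIV K)"
  using compactin_PiE[of "\<lambda>_. euclidean" UNIV K] assms
  by (simp add: euclidean_product_topology)

lemma tendsto_coordinate:
  fixes f :: "nat \<Rightarrow> 'a \<Rightarrow> 'b::topological_space"
  assumes "f \<longlonglongrightarrow> g" shows "(\<lambda>k. f k i) \<longlonglongrightarrow> g i"
  using continuous_on_tendsto_compose[OF continuous_on_product_coordinates assms] by simp

lemma closed_Collect_Ball:
  "(\<And>i. i \<in> A \<Longrightarrow> closed {x. P i x}) \<Longrightarrow> closed {x. \<forall>i\<in>A. P i x}"
  by (simp add: Collect_ball_eq closed_INT)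

section \<open>Scalar operators on a graph of bounded degree\<close>

text \<open>Collects what the argument uses of the integer lattice. The uniform degree bound makes
  edge sums of square-summable functions converge, and the symmetry of \<open>N\<close> makes the
  adjacency operator symmetric.\<close>

locale bounded_degree_graph =
  fixes L :: "'a set" and N :: "'a \<Rightarrow> 'a set" and D :: nat
  assumes countable_L: "countable L"
    and nonempty_L: "L \<noteq> {}"
    and N_subset: "v \<in> L \<Longrightarrow> N v \<subseteq> L"
    and finite_N: "v \<in> L \<Longrightarrow> finite (N v)"
    and card_N: "v \<in> L \<Longrightarrow> card (N v) \<le> D"
    and N_sym: "v \<in> L \<Longrightarrow> u \<in> L \<Longrightarrow> u \<in> N v \<longleftrightarrow> v \<in> N u"
begin

section \<open>Symmetry of the adjacency operator and the rank-one identity\<close>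

definition adj :: "('a \<Rightarrow> real) \<Rightarrow> 'a \<Rightarrow> real" where
  "adj f v = (\<Sum>u\<in>N v. f u)"

definition sol :: "real \<Rightarrow> ('a \<Rightarrow> real) \<Rightarrow> real \<Rightarrow> ('a \<Rightarrow> real) \<Rightarrow> bool" where
  "sol w \<omega> E f \<longleftrightarrow> ell2 L f \<and> (\<forall>v\<in>L. adj f v + w * \<omega> v * f v = E * f v)"

lemma swap_Sigma_N: "bij_betw prod.swap (Sigma L N) (Sigma L N)"
proof -
  have "(u, v) \<in> Sigma L N" if "(v, u) \<in> Sigma L N" for v u
  proof -
    have v: "v \<in> L" and u: "u \<in> N v" using that by auto
    from u N_subset[OF v] have "u \<in> L" by (rule rev_subsetD)
    then show ?thesis using u v N_sym[of v u] by simp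
  qed
  then have swap: "prod.swap \<in> Sigma L N \<rightarrow> Sigma L N"
    by (metis Pi_I surj_pair swap_simp)
  show ?thesis
    by (rule bij_betwI[OF swap swap]) (rule swap_swap)+
qed

text \<open>The terms are dominated by the sum of the squares of \<open>f v\<close> and
  \<open>g u\<close>. Each vertex starts at most \<open>D\<close> directed edges, and
  \<open>swap_Sigma_N\<close> treats the end points in the same way.\<close>

lemma summable_Sigma_N:
  assumes f: "ell2 L f" and g: "ell2 L g"
  shows "(\<lambda>(v, u). f v * g u) summable_on Sigma L N"
proof -
  have sq: "(\<lambda>(v, u). (h v)\<^sup>2) summable_on Sigma L N" if h: "ell2 L h" for h :: "'a \<Rightarrow> real"
  proof (rule summable_on_SigmaI)
    show "((\<lambda>u. case (v, u) of (v, u) \<Rightarrow> (h v)\<^sup>2) has_sum (of_nat (card (N v)) * (h v)\<^sup>2)) (N v)"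
      if "v \<in> L" for v
      using has_sum_finite[OF finite_N[OF that], of "\<lambda>u. (h v)\<^sup>2"] by simp
    have "(\<lambda>v. real D * (h v)\<^sup>2) summable_on L"
      using h unfolding ell2_def by (rule summable_on_cmult_right)
    then show "(\<lambda>v. real (card (N v)) * (h v)\<^sup>2) summable_on L"
      by (rule summable_on_comparison_test) (use card_N in \<open>auto intro!: mult_right_mono\<close>)
  qed simp
  have "(\<lambda>(v, u). (g u)\<^sup>2) summable_on Sigma L N"
    using summable_on_reindex_bij_betw[OF swap_Sigma_N, of "\<lambda>(v, u). (g v)\<^sup>2"] sq[OF g]
    by (simp add: case_prod_unfold)
  with sq[OF f] have "(\<lambda>x. (case x of (v, u) \<Rightarrow> (f v)\<^sup>2) + (case x of (v, u) \<Rightarrow> (g u)\<^sup>2)) summable_on Sigma L N"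
    by (rule summable_on_add)
  then have "(\<lambda>x. norm (case x of (v, u) \<Rightarrow> f v * g u)) summable_on Sigma L N"
  proof (rule summable_on_comparison_test)
    fix x :: "'a \<times> 'a"
    obtain v u where x: "x = (v, u)" by fastforce
    have "2 * (\<bar>f v\<bar> * \<bar>g u\<bar>) \<le> (f v)\<^sup>2 + (g u)\<^sup>2"
      using sum_squares_bound[of "\<bar>f v\<bar>" "\<bar>g u\<bar>"] by simp
    moreover have "0 \<le> \<bar>f v\<bar> * \<bar>g u\<bar>" by simp
    ultimately show "norm (case x of (v, u) \<Rightarrow> f v * g u)
        \<le> (case x of (v, u) \<Rightarrow> (f v)\<^sup>2) + (case x of (v, u) \<Rightarrow> (g u)\<^sup>2)"
      unfolding x real_norm_def prod.case abs_mult by linarith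
  qed simp
  then show ?thesis
    by (rule summable_on_iff_abs_summable_on_real[THEN iffD2])
qed

lemma adj_has_sum:
  assumes f: "ell2 L f" and g: "ell2 L g"
  shows "((\<lambda>v. f v * adj g v) has_sum (\<Sum>\<^sub>\<infinity>(v, u)\<in>Sigma L N. f v * g u)) L"
proof -
  have s: "(\<lambda>(v, u). f v * g u) summable_on Sigma L N"
    by (rule summable_Sigma_N[OF f g])
  have fin: "((\<lambda>u. (\<lambda>(v, u). f v * g u) (v, u)) has_sum (f v * adj g v)) (N v)" if "v \<in> L" for v
    using has_sum_finite[OF finite_N[OF that], of "\<lambda>u. f v * g u"]
    by (simp add: adj_def sum_distrib_left)
  show ?thesis
    by (rule has_sum_SigmaD[OF has_sum_infsum[OF s]]) (use fin in auto)
qed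

text \<open>Both sides are one absolutely convergent sum over directed edges, read in the two
  orientations.\<close>

lemma adj_symmetric:
  assumes f: "ell2 L f" and g: "ell2 L g"
  shows "(\<Sum>\<^sub>\<infinity>v\<in>L. f v * adj g v) = (\<Sum>\<^sub>\<infinity>v\<in>L. g v * adj f v)"
proof -
  have "(\<Sum>\<^sub>\<infinity>(v, u)\<in>Sigma L N. f v * g u) = (\<Sum>\<^sub>\<infinity>(v, u)\<in>Sigma L N. g v * f u)"
    using infsum_reindex_bij_betw[OF swap_Sigma_N, of "\<lambda>(v, u). f v * g u"]
    by (simp add: case_prod_unfold mult.commute)
  then show ?thesis
    using infsumI[OF adj_has_sum[OF f g]] infsumI[OF adj_has_sum[OF g f]] by simp
qed

lemma adj_summable: "ell2 L f \<Longrightarrow> ell2 L g \<Longrightarrow> (\<lambda>v. f v * adj g v) summable_on L"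
  using adj_has_sum summable_on_def by blast

text \<open>Green's identity: pairing each equation with the other function cancels the adjacency
  terms, and the difference of the potentials survives only at \<open>n\<close>.\<close>

lemma sol_rank_one_identity:
  assumes f: "sol w \<omega> E f" and f': "sol w \<omega>' E' f'" and n: "n \<in> L"
    and eq: "\<And>v. v \<in> L \<Longrightarrow> v \<noteq> n \<Longrightarrow> \<omega>' v = \<omega> v"
  shows "(E - E') * inner_on L f' f = w * (\<omega> n - \<omega>' n) * (f' n * f n)"
proof -
  have l: "ell2 L f" "ell2 L f'" using f f' by (auto simp: sol_def)
  have sd: "0 = (\<Sum>\<^sub>\<infinity>v\<in>L. f' v * adj f v - f v * adj f' v)"
    using adj_symmetric[OF l] adj_summable[OF l] adj_summable[OF l(2,1)]
    by (subst infsum_diff_real) auto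
  have "f' v * adj f v - f v * adj f' v
        = (E - E') * (f' v * f v) - w * (\<omega> v - \<omega>' v) * (f' v * f v)" if "v \<in> L" for v
  proof -
    have "adj f v + w * \<omega> v * f v = E * f v" "adj f' v + w * \<omega>' v * f' v = E' * f' v"
      using f f' that by (simp_all add: sol_def)
    then have *: "adj f v = E * f v - w * \<omega> v * f v" "adj f' v = E' * f' v - w * \<omega>' v * f' v"
      by linarith+
    show ?thesis unfolding * by (simp add: algebra_simps)
  qed
  then have "(\<Sum>\<^sub>\<infinity>v\<in>L. f' v * adj f v - f v * adj f' v)
      = (\<Sum>\<^sub>\<infinity>v\<in>L. (E - E') * (f' v * f v) - w * (\<omega> v - \<omega>' v) * (f' v * f v))"
    by (rule infsum_cong)
  with sd have "0 = (\<Sum>\<^sub>\<infinity>v\<in>L. (E - E') * (f' v * f v) - w * (\<omega> v - \<omega>' v) * (f' v * f v))"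
    by (rule trans)
  also have "\<dots> = (\<Sum>\<^sub>\<infinity>v\<in>L. (E - E') * (f' v * f v)) - (\<Sum>\<^sub>\<infinity>v\<in>L. w * (\<omega> v - \<omega>' v) * (f' v * f v))"
  proof (rule infsum_diff_real)
    show "(\<lambda>v. (E - E') * (f' v * f v)) summable_on L"
      using l by (intro summable_on_cmult_right ell2_mult_summable)
    have "{v \<in> L. w * (\<omega> v - \<omega>' v) * (f' v * f v) \<noteq> 0} \<subseteq> {n}"
      using eq by force
    then show "(\<lambda>v. w * (\<omega> v - \<omega>' v) * (f' v * f v)) summable_on L"
      by (intro finite_nonzero_values_imp_summable_on) (rule finite_subset, auto)
  qed
  also have "(\<Sum>\<^sub>\<infinity>v\<in>L. w * (\<omega> v - \<omega>' v) * (f' v * f v)) = (\<Sum>\<^sub>\<infinity>v\<in>{n}. w * (\<omega> v - \<omega>' v) * (f' v * f v))"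
  proof (rule infsum_cong_neutral)
    show "w * (\<omega> v - \<omega>' v) * (f' v * f v) = 0" if "v \<in> L - {n}" for v
      using eq[of v] that by simp
  qed (use n in auto)
  also have "(\<Sum>\<^sub>\<infinity>v\<in>L. (E - E') * (f' v * f v)) = (E - E') * inner_on L f' f"
    unfolding inner_on_def by (rule infsum_cmult_right')
  finally show ?thesis by simp
qed

lemma sol_ell2: "sol w \<omega> E f \<Longrightarrow> ell2 L f"
  by (simp add: sol_def)

lemma sol_lincomb:
  assumes "sol w \<omega> E f" "sol w \<omega> E g"
  shows "sol w \<omega> E (\<lambda>v. a * f v + b * g v)"
  unfolding sol_def
proof (intro conjI ballI)
  show "ell2 L (\<lambda>v. a * f v + b * g v)"
    using assms by (intro ell2_add ell2_cmult sol_ell2)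
  fix v assume "v \<in> L"
  then have "adj f v + w * \<omega> v * f v = E * f v" "adj g v + w * \<omega> v * g v = E * g v"
    using assms by (auto simp: sol_def)
  then have *: "adj f v = E * f v - w * \<omega> v * f v" "adj g v = E * g v - w * \<omega> v * g v"
    by linarith+
  have "adj (\<lambda>v. a * f v + b * g v) v = a * adj f v + b * adj g v"
    by (simp add: adj_def sum.distrib sum_distrib_left)
  then show "adj (\<lambda>v. a * f v + b * g v) v + w * \<omega> v * (a * f v + b * g v) = E * (a * f v + b * g v)"
    unfolding * by (simp add: algebra_simps)
qed

lemma sol_cmult: "sol w \<omega> E f \<Longrightarrow> sol w \<omega> E (\<lambda>v. a * f v)"
  using sol_lincomb[of w \<omega> E f f a 0] by simp

lemma sol_cong:
  assumes "\<And>v. v \<in> L \<Longrightarrow> \<omega> v = \<omega>' v" "\<And>v. v \<in> L \<Longrightarrow> f v = f' v"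
  shows "sol w \<omega> E f \<longleftrightarrow> sol w \<omega>' E f'"
proof -
  have "adj f v = adj f' v" if "v \<in> L" for v
    unfolding adj_def using N_subset[OF that] assms(2) by (intro sum.cong) auto
  moreover have "ell2 L f \<longleftrightarrow> ell2 L f'"
    unfolding ell2_def by (rule summable_on_cong) (simp add: assms)
  ultimately show ?thesis
    unfolding sol_def using assms by simp
qed

section \<open>Bad configurations: countable sections, closedness and null measure\<close>

text \<open>
  The exceptional set is covered by countably many sets \<open>bad w1 w2 n F s t r R\<close> with rational
  parameters. Each constraint in \<open>witness\<close> is closed for pointwise convergence, and \<open>E\<close>, \<open>f\<close>, \<open>g\<close>
  range over a compact product; hence \<open>bad\<close> is closed, which yields the measurability needed for
  Fubini. This is why \<open>\<parallel>f\<parallel>\<^sup>2\<close>, only lower semicontinuous, is bounded from below through a finite sum.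
\<close>

definition witness ::
  "real \<Rightarrow> real \<Rightarrow> 'a \<Rightarrow> 'a set \<Rightarrow> real \<Rightarrow> real \<Rightarrow> real \<Rightarrow> real \<Rightarrow>
    ('a \<Rightarrow> real) \<Rightarrow> real \<Rightarrow> ('a \<Rightarrow> real) \<Rightarrow> ('a \<Rightarrow> real) \<Rightarrow> bool" where
  "witness w1 w2 n F s t r R \<omega> E f g \<longleftrightarrow> \<bar>E\<bar> \<le> R \<and>
     sol w1 \<omega> E f \<and> inner_on L f f \<le> 1 \<and> s \<le> (\<Sum>v\<in>F. (f v)\<^sup>2) \<and> w1 * (f n)\<^sup>2 * t \<le> r \<and>
     sol w2 \<omega> E g \<and> inner_on L g g \<le> t \<and> g n = 1"

definition bad ::
  "real \<Rightarrow> real \<Rightarrow> 'a \<Rightarrow> 'a set \<Rightarrow> real \<Rightarrow> real \<Rightarrow> real \<Rightarrow> real \<Rightarrow> ('a \<Rightarrow> real) \<Rightarrow> bool" where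
  "bad w1 w2 n F s t r R \<omega> \<longleftrightarrow> (\<exists>E f g. witness w1 w2 n F s t r R \<omega> E f g)"

lemma witness_cong:
  assumes "n \<in> L" "F \<subseteq> L" "\<And>v. v \<in> L \<Longrightarrow> \<omega> v = \<omega>' v" "\<And>v. v \<in> L \<Longrightarrow> f v = f' v"
    "\<And>v. v \<in> L \<Longrightarrow> g v = g' v"
  shows "witness w1 w2 n F s t r R \<omega> E f g \<longleftrightarrow> witness w1 w2 n F s t r R \<omega>' E f' g'"
proof -
  have "(\<Sum>v\<in>F. (f v)\<^sup>2) = (\<Sum>v\<in>F. (f' v)\<^sup>2)"
    using assms(2,4) by (intro sum.cong) auto
  moreover have "sol w1 \<omega> E f \<longleftrightarrow> sol w1 \<omega>' E f'" "sol w2 \<omega> E g \<longleftrightarrow> sol w2 \<omega>' E g'"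
    using assms by (auto intro!: sol_cong)
  moreover have "inner_on L f f = inner_on L f' f'" "inner_on L g g = inner_on L g' g'"
    using assms by (auto intro!: inner_on_cong)
  ultimately show ?thesis
    unfolding witness_def using assms(1,4,5) by simp
qed

lemma bad_cong:
  assumes "n \<in> L" "F \<subseteq> L" "\<And>v. v \<in> L \<Longrightarrow> \<omega> v = \<omega>' v"
  shows "bad w1 w2 n F s t r R \<omega> \<longleftrightarrow> bad w1 w2 n F s t r R \<omega>'"
proof -
  have "witness w1 w2 n F s t r R \<omega> E f g \<longleftrightarrow> witness w1 w2 n F s t r R \<omega>' E f g" for E f g
    by (rule witness_cong) (use assms in auto)
  then show ?thesis unfolding bad_def by metis
qed

text \<open>One witness is chosen for each bad value at \<open>n\<close>. The identity
  \<open>key\<close> for two different values would, in a weak limit, contradict the gap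
  \<open>r < w2 * s\<close>; so the chosen pairs \<open>(f, g)\<close> are isolated from each
  other.\<close>

lemma countable_bad_section:
  assumes n: "n \<in> L" and F: "finite F" "F \<subseteq> L" and w: "0 < w1" "0 < w2" and r: "r < w2 * s"
  shows "countable {x. bad w1 w2 n F s t r R (X(n := x))}"
proof -
  define S where "S = {x. bad w1 w2 n F s t r R (X(n := x))}"
  have "\<forall>x\<in>S. \<exists>p. witness w1 w2 n F s t r R (X(n := x)) (fst p) (fst (snd p)) (snd (snd p))"
    unfolding S_def bad_def by simp
  then obtain p where p: "\<And>x. x \<in> S \<Longrightarrow> witness w1 w2 n F s t r R (X(n := x)) (fst (p x)) (fst (snd (p x))) (snd (snd (p x)))"
    by metis
  define E where "E x = fst (p x)" for x
  define f where "f x = fst (snd (p x))" for x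
  define g where "g x = snd (snd (p x))" for x
  have wit: "witness w1 w2 n F s t r R (X(n := x)) (E x) (f x) (g x)" if "x \<in> S" for x
    unfolding E_def f_def g_def by (rule p[OF that])
  have sf: "sol w1 (X(n := x)) (E x) (f x)" and sg: "sol w2 (X(n := x)) (E x) (g x)"
    and f1: "inner_on L (f x) (f x) \<le> 1" and gt: "inner_on L (g x) (g x) \<le> t" and gn: "g x n = 1"
    if "x \<in> S" for x
    using wit[OF that] by (auto simp: witness_def)
  have key: "w2 * inner_on L (f y) (f x) = w1 * (f y n * f x n) * inner_on L (g y) (g x)"
    if "x \<in> S" "y \<in> S" "x \<noteq> y" for x y
  proof -
    have 1: "(E x - E y) * inner_on L (f y) (f x) = w1 * (x - y) * (f y n * f x n)"
      using sol_rank_one_identity[OF sf[OF that(1)] sf[OF that(2)] n] by simp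
    have 2: "(E x - E y) * inner_on L (g y) (g x) = w2 * (x - y)"
      using sol_rank_one_identity[OF sg[OF that(1)] sg[OF that(2)] n] gn that by simp
    \<comment> \<open>Because \<open>g\<close> is normalised to \<open>1\<close> at
      \<open>n\<close>, the right side of \<open>2\<close> is nonzero: different values at
      \<open>n\<close> have different energies, and the factor can be cancelled below.\<close>
    have d: "E x - E y \<noteq> 0" using 2 w that(3) by auto
    have "(E x - E y) * (w2 * inner_on L (f y) (f x)) = w2 * (w1 * (x - y) * (f y n * f x n))"
      using arg_cong[OF 1, of "\<lambda>u. w2 * u"] by (simp only: ac_simps)
    also have "\<dots> = w1 * (f y n * f x n) * (w2 * (x - y))" by (simp only: ac_simps)
    also have "\<dots> = (E x - E y) * (w1 * (f y n * f x n) * inner_on L (g y) (g x))"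
      using arg_cong[OF 2, of "\<lambda>u. w1 * (f y n * f x n) * u"] by (simp only: ac_simps)
    finally show ?thesis using d by (simp only: mult_cancel_left) simp
  qed
  \<comment> \<open>The chain through \<open>t\<close>, \<open>r\<close>, \<open>s\<close> excludes
    the equality that \<open>key\<close> would give with \<open>y\<close> replaced by
    \<open>x\<close>.\<close>
  have strict: "w1 * (f x n * f x n) * inner_on L (g x) (g x) < w2 * inner_on L (f x) (f x)"
    if "x \<in> S" for x
  proof -
    have "w1 * (f x n)\<^sup>2 * inner_on L (g x) (g x) \<le> w1 * (f x n)\<^sup>2 * t"
      using gt[OF that] w by (intro mult_left_mono) auto
    also have "\<dots> \<le> r" using wit[OF that] by (simp add: witness_def)
    also have "\<dots> < w2 * s" by (rule r)
    also have "\<dots> \<le> w2 * inner_on L (f x) (f x)"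
    proof (rule mult_left_mono)
      have "s \<le> (\<Sum>v\<in>F. (f x v)\<^sup>2)" using wit[OF that] by (simp add: witness_def)
      also have "\<dots> \<le> inner_on L (f x) (f x)"
        by (rule sum_le_inner_on_self[OF sol_ell2[OF sf[OF that]] F])
      finally show "s \<le> inner_on L (f x) (f x)" .
    qed (use w in simp)
    finally show ?thesis by (simp only: power2_eq_square)
  qed
  let ?e = "from_nat_into L"
  \<comment> \<open>Listing the values along an enumeration of \<open>L\<close> places the pairs in
    a second countable space, whether or not the vertex type is countable.\<close>
  define G where "G x = ((\<lambda>k. f x (?e k)), (\<lambda>k. g x (?e k)))" for x
  have eL: "\<exists>k. v = ?e k" if "v \<in> L" for v
    using from_nat_into_surj[OF countable_L that] by metis
  have inj: "inj_on G S"
  proof (rule inj_onI, rule ccontr)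
    fix x y assume xy: "x \<in> S" "y \<in> S" "G x = G y" "x \<noteq> y"
    have "f y v = f x v" "g y v = g x v" if "v \<in> L" for v
      using eL[OF that] xy(3) by (auto simp: G_def fun_eq_iff)
    then have "inner_on L (f y) (f x) = inner_on L (f x) (f x)" "inner_on L (g y) (g x) = inner_on L (g x) (g x)"
      "f y n = f x n"
      using n by (auto intro!: inner_on_cong)
    then show False
      using key[OF xy(1,2,4)] strict[OF xy(1)] by simp
  qed
  have "countable (G ` S)"
  proof (rule countable_if_all_isolated)
    fix z assume "z \<in> G ` S"
    then obtain x where x: "x \<in> S" "z = G x" by blast
    show "\<not> z islimpt G ` S"
    proof
      assume "z islimpt G ` S"
      then obtain h where h: "\<forall>k. h k \<in> G ` S - {z}" "h \<longlonglongrightarrow> z"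
        unfolding islimpt_sequential by blast
      then have "\<forall>k. \<exists>y. y \<in> S \<and> y \<noteq> x \<and> h k = G y" using x by blast
      then obtain y where y: "\<And>k. y k \<in> S" "\<And>k. y k \<noteq> x" "\<And>k. h k = G (y k)" by metis
      have lim: "(\<lambda>k. f (y k) v) \<longlonglongrightarrow> f x v" "(\<lambda>k. g (y k) v) \<longlonglongrightarrow> g x v" if v: "v \<in> L" for v
      proof -
        obtain i where i: "v = ?e i" using eL[OF v] by blast
        show "(\<lambda>k. f (y k) v) \<longlonglongrightarrow> f x v"
          using tendsto_coordinate[OF tendsto_fst[OF h(2)], of i] by (simp add: i y(3) x(2) G_def)
        show "(\<lambda>k. g (y k) v) \<longlonglongrightarrow> g x v"
          using tendsto_coordinate[OF tendsto_snd[OF h(2)], of i] by (simp add: i y(3) x(2) G_def)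
      qed
      \<comment> \<open>The bounds \<open>1\<close> and \<open>t\<close> from \<open>witness\<close>
        make both sequences norm-bounded, so their pointwise limits are weak limits.\<close>
      have "(\<lambda>k. inner_on L (f (y k)) (f x)) \<longlonglongrightarrow> inner_on L (f x) (f x)"
        by (rule inner_on_tendsto[where B = 1]) (use f1 y x sf sol_ell2 lim in blast)+
      then have lhs: "(\<lambda>k. w2 * inner_on L (f (y k)) (f x)) \<longlonglongrightarrow> w2 * inner_on L (f x) (f x)"
        by (rule tendsto_mult_left)
      have "(\<lambda>k. inner_on L (g (y k)) (g x)) \<longlonglongrightarrow> inner_on L (g x) (g x)"
        by (rule inner_on_tendsto[where B = t]) (use gt y x sg sol_ell2 lim in blast)+
      then have rhs: "(\<lambda>k. w1 * (f (y k) n * f x n) * inner_on L (g (y k)) (g x))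
          \<longlonglongrightarrow> w1 * (f x n * f x n) * inner_on L (g x) (g x)"
        by (intro tendsto_mult tendsto_const lim n)
      have "w2 * inner_on L (f (y k)) (f x) = w1 * (f (y k) n * f x n) * inner_on L (g (y k)) (g x)" for k
        by (rule key) (use x y in auto)
      with lhs have "(\<lambda>k. w1 * (f (y k) n * f x n) * inner_on L (g (y k)) (g x)) \<longlonglongrightarrow> w2 * inner_on L (f x) (f x)"
        by simp
      with rhs have "w1 * (f x n * f x n) * inner_on L (g x) (g x) = w2 * inner_on L (f x) (f x)"
        by (rule LIMSEQ_unique)
      then show False using strict[OF x(1)] by simp
    qed
  qed
  then show ?thesis
    unfolding S_def[symmetric] using inj by (rule countable_image_inj_on)
qed

text \<open>The set is the projection of a closed relation \<open>T\<close> along a compact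
  \<open>K\<close>. Indexing by an enumeration of \<open>L\<close> gives a countable product of
  lines, whose Borel sets are accessible through the coordinates.\<close>

lemma closed_bad:
  assumes n: "n \<in> L" and F: "finite F" "F \<subseteq> L"
  shows "closed {\<omega> :: nat \<Rightarrow> real. bad w1 w2 n F s t r R (\<lambda>v. \<omega> (to_nat_on L v))}"
proof -
  let ?t = "to_nat_on L" and ?e = "from_nat_into L"
  \<comment> \<open>\<open>K\<close> is large enough for every witness: the norm bounds give
    \<open>1\<close> for the values of \<open>f\<close> and \<open>1 + t\<close> for those of
    \<open>g\<close>, the latter from \<open>2 * x <= 1 + x * x\<close> so that no square root is
    needed.\<close>
  define K :: "(real \<times> (nat \<Rightarrow> real) \<times> (nat \<Rightarrow> real)) set"
    where "K = {-R..R} \<times> PiE UNIV (\<lambda>_. {-1..1}) \<times> PiE UNIV (\<lambda>_. {-(1 + t)..1 + t})"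
  define T where "T = {p :: (nat \<Rightarrow> real) \<times> real \<times> (nat \<Rightarrow> real) \<times> (nat \<Rightarrow> real).
    witness w1 w2 n F s t r R (\<lambda>v. fst p (?t v)) (fst (snd p))
      (\<lambda>v. fst (snd (snd p)) (?t v)) (\<lambda>v. snd (snd (snd p)) (?t v))}"
  have K: "compact K"
    unfolding K_def by (intro compact_Times compact_UNIV_PiE compact_Icc)
  have [continuous_intros]: "continuous_on UNIV (\<lambda>p :: (nat \<Rightarrow> real) \<times> real \<times> (nat \<Rightarrow> real) \<times> (nat \<Rightarrow> real). fst p i)"
    "continuous_on UNIV (\<lambda>p :: (nat \<Rightarrow> real) \<times> real \<times> (nat \<Rightarrow> real) \<times> (nat \<Rightarrow> real). fst (snd (snd p)) i)"
    "continuous_on UNIV (\<lambda>p :: (nat \<Rightarrow> real) \<times> real \<times> (nat \<Rightarrow> real) \<times> (nat \<Rightarrow> real). snd (snd (snd p)) i)" for i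
    by (rule continuous_on_product_then_coordinatewise, intro continuous_intros)+
  have sol_le: "sol w \<omega> E f \<and> inner_on L f f \<le> B \<longleftrightarrow>
      (\<forall>A\<in>{A. finite A \<and> A \<subseteq> L}. (\<Sum>v\<in>A. (f v)\<^sup>2) \<le> B) \<and> (\<forall>v\<in>L. adj f v + w * \<omega> v * f v = E * f v)" for w \<omega> E f B
    using ell2_iff_bounded_sums[of L f B] unfolding sol_def by blast
  have "T = {p. \<bar>fst (snd p)\<bar> \<le> R} \<inter>
      ({p. (\<forall>A\<in>{A. finite A \<and> A \<subseteq> L}. (\<Sum>v\<in>A. (fst (snd (snd p)) (?t v))\<^sup>2) \<le> 1)} \<inter>
       {p. \<forall>v\<in>L. (\<Sum>u\<in>N v. fst (snd (snd p)) (?t u)) + w1 * fst p (?t v) * fst (snd (snd p)) (?t v)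
          = fst (snd p) * fst (snd (snd p)) (?t v)}) \<inter>
      {p. s \<le> (\<Sum>v\<in>F. (fst (snd (snd p)) (?t v))\<^sup>2)} \<inter>
      {p. w1 * (fst (snd (snd p)) (?t n))\<^sup>2 * t \<le> r} \<inter>
      ({p. (\<forall>A\<in>{A. finite A \<and> A \<subseteq> L}. (\<Sum>v\<in>A. (snd (snd (snd p)) (?t v))\<^sup>2) \<le> t)} \<inter>
       {p. \<forall>v\<in>L. (\<Sum>u\<in>N v. snd (snd (snd p)) (?t u)) + w2 * fst p (?t v) * snd (snd (snd p)) (?t v)
          = fst (snd p) * snd (snd (snd p)) (?t v)}) \<inter>
      {p. snd (snd (snd p)) (?t n) = 1}" (is "_ = ?T")
  proof (rule set_eqI)
    fix p
    show "p \<in> T \<longleftrightarrow> p \<in> ?T"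
      using sol_le[of w1 "\<lambda>v. fst p (?t v)" "fst (snd p)" "\<lambda>v. fst (snd (snd p)) (?t v)" 1]
        sol_le[of w2 "\<lambda>v. fst p (?t v)" "fst (snd p)" "\<lambda>v. snd (snd (snd p)) (?t v)" t]
      unfolding T_def witness_def adj_def Int_iff mem_Collect_eq by argo
  qed
  moreover have "closed ?T"
    by (intro closed_Int closed_Collect_Ball closed_Collect_le closed_Collect_eq continuous_intros)
  ultimately have "closed T" by simp
  then have "closed {x. \<exists>y\<in>K. (x, y) \<in> T}"
    by (rule closed_compact_projection'[OF K])
  moreover have "{\<omega>. bad w1 w2 n F s t r R (\<lambda>v. \<omega> (?t v))} = {x. \<exists>y\<in>K. (x, y) \<in> T}"
  proof (intro set_eqI iffI; clarsimp simp only: mem_Collect_eq)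
    fix \<omega> :: "nat \<Rightarrow> real" assume "bad w1 w2 n F s t r R (\<lambda>v. \<omega> (?t v))"
    then obtain E f g where w: "witness w1 w2 n F s t r R (\<lambda>v. \<omega> (?t v)) E f g"
      unfolding bad_def by blast
    have eL: "?e k \<in> L" for k using nonempty_L by (rule from_nat_into)
    have sq: "(h (?e k))\<^sup>2 \<le> B" if "ell2 L h" "inner_on L h h \<le> B" for h B k
      using sum_le_inner_on_self[OF that(1), of "{?e k}"] eL[of k] that(2) by simp
    have f1: "(f (?e k))\<^sup>2 \<le> 1" and g1: "(g (?e k))\<^sup>2 \<le> t" for k
      using w sq sol_ell2 unfolding witness_def by blast+
    have "\<bar>f (?e k)\<bar> \<le> 1" for k
      using f1[of k] by (simp add: abs_square_le_1)
    moreover have "\<bar>g (?e k)\<bar> \<le> 1 + t" for k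
    proof -
      have "0 \<le> (\<bar>g (?e k)\<bar> - 1)\<^sup>2" by simp
      then have "2 * \<bar>g (?e k)\<bar> \<le> 1 + \<bar>g (?e k)\<bar>\<^sup>2"
        by (simp add: power2_diff)
      then show ?thesis using g1[of k] by simp
    qed
    moreover have "\<bar>E\<bar> \<le> R" using w by (simp add: witness_def)
    ultimately have "(E, (\<lambda>k. f (?e k)), (\<lambda>k. g (?e k))) \<in> K"
      unfolding K_def by (auto simp: abs_le_iff) (smt (verit))+
    \<comment> \<open>Passing \<open>f\<close> and \<open>g\<close> through the enumeration changes
      nothing on \<open>L\<close>, and \<open>witness\<close> sees only values on
      \<open>L\<close>.\<close>
    moreover have "(\<omega>, E, (\<lambda>k. f (?e k)), (\<lambda>k. g (?e k))) \<in> T"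
    proof -
      have "witness w1 w2 n F s t r R (\<lambda>v. \<omega> (?t v)) E (\<lambda>v. f (?e (?t v))) (\<lambda>v. g (?e (?t v)))"
        by (rule witness_cong[THEN iffD1, OF n F(2) _ _ _ w]) (simp_all add: countable_L)
      then show ?thesis by (simp add: T_def)
    qed
    ultimately show "\<exists>y\<in>K. (\<omega>, y) \<in> T" by blast
  next
    fix \<omega> E f g assume "(\<omega>, E, f, g) \<in> T"
    then show "bad w1 w2 n F s t r R (\<lambda>v. \<omega> (?t v))"
      unfolding T_def bad_def by auto
  qed
  ultimately show ?thesis by simp
qed

lemma bad_measurable:
  assumes n: "n \<in> L" and F: "finite F" "F \<subseteq> L" and \<mu>: "sets \<mu> = sets borel"
  shows "{\<omega> \<in> space (PiM L (\<lambda>_. \<mu>)). bad w1 w2 n F s t r R \<omega>} \<in> sets (PiM L (\<lambda>_. \<mu>))"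
proof -
  let ?M = "PiM L (\<lambda>_. \<mu>)" and ?G = "\<lambda>\<omega> k. \<omega> (from_nat_into L k)"
  let ?C = "{\<omega> :: nat \<Rightarrow> real. bad w1 w2 n F s t r R (\<lambda>v. \<omega> (to_nat_on L v))}"
  have "?G \<in> borel_measurable ?M"
  proof (rule measurable_coordinatewise_then_product)
    fix k
    have "(\<lambda>\<omega>. \<omega> (from_nat_into L k)) \<in> measurable ?M \<mu>"
      by (rule measurable_component_singleton) (rule from_nat_into[OF nonempty_L])
    then show "(\<lambda>\<omega>. \<omega> (from_nat_into L k)) \<in> borel_measurable ?M"
      by (simp only: measurable_cong_sets[OF refl \<mu>])
  qed
  then have "?G -` ?C \<inter> space ?M \<in> sets ?M"
    by (rule measurable_sets) (rule borel_closed[OF closed_bad[OF n F]])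
  moreover have "?G -` ?C \<inter> space ?M = {\<omega> \<in> space ?M. bad w1 w2 n F s t r R \<omega>}"
  proof -
    have "bad w1 w2 n F s t r R (\<lambda>v. \<omega> (from_nat_into L (to_nat_on L v))) \<longleftrightarrow> bad w1 w2 n F s t r R \<omega>" for \<omega>
      by (rule bad_cong[OF n F(2)]) (simp add: countable_L)
    then show ?thesis by auto
  qed
  ultimately show ?thesis by simp
qed

text \<open>Fubini in the coordinate at \<open>n\<close>: with the other coordinates fixed, the bad
  values are countable, hence null for the atomless \<open>\<mu>\<close>.\<close>

lemma AE_not_bad:
  assumes n: "n \<in> L" and F: "finite F" "F \<subseteq> L" and w: "0 < w1" "0 < w2" and r: "r < w2 * s"
    and \<mu>: "prob_space \<mu>" "sets \<mu> = sets borel" "\<And>x. emeasure \<mu> {x} = 0"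
  shows "AE \<omega> in PiM L (\<lambda>_. \<mu>). \<not> bad w1 w2 n F s t r R \<omega>"
proof -
  let ?M = "PiM L (\<lambda>_. \<mu>)" and ?M' = "PiM (L - {n}) (\<lambda>_. \<mu>)" and ?up = "\<lambda>(x, X). X(n := x)"
  let ?bad = "bad w1 w2 n F s t r R"
  interpret \<mu>: prob_space \<mu> by fact
  interpret M': prob_space ?M' by (intro prob_space_PiM \<mu>)
  interpret pair_sigma_finite \<mu> ?M' ..
  have L: "insert n (L - {n}) = L" using n by auto
  have distr: "distr (\<mu> \<Otimes>\<^sub>M ?M') ?M ?up = ?M"
    using distr_pair_PiM_eq_PiM[of "L - {n}" "\<lambda>_. \<mu>" n] \<mu>(1) unfolding L by simp
  have up: "?up \<in> measurable (\<mu> \<Otimes>\<^sub>M ?M') ?M"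
    using measurable_fun_upd[of L "L - {n}" n snd "\<mu> \<Otimes>\<^sub>M ?M'" "\<lambda>_. \<mu>" fst] L
    by (simp add: case_prod_unfold)
  have meas: "{\<omega> \<in> space ?M. \<not> ?bad \<omega>} \<in> sets ?M"
    using sets.Diff[OF sets.top bad_measurable[OF n F \<mu>(2), of w1 w2 s t r R]]
    by (simp add: set_diff_eq conj_commute cong: conj_cong)
  have meas': "{z \<in> space (\<mu> \<Otimes>\<^sub>M ?M'). \<not> ?bad (?up z)} \<in> sets (\<mu> \<Otimes>\<^sub>M ?M')"
  proof -
    have "{z \<in> space (\<mu> \<Otimes>\<^sub>M ?M'). \<not> ?bad (?up z)}
        = ?up -` {\<omega> \<in> space ?M. \<not> ?bad \<omega>} \<inter> space (\<mu> \<Otimes>\<^sub>M ?M')"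
      using measurable_space[OF up] by blast
    then show ?thesis using measurable_sets[OF up meas] by simp
  qed
  have "AE x in \<mu>. \<not> ?bad (X(n := x))" for X
  proof (rule AE_I')
    have "{x. ?bad (X(n := x))} = (\<Union>x\<in>{x. ?bad (X(n := x))}. {x})" by auto
    moreover have "\<dots> \<in> null_sets \<mu>"
      by (rule null_sets_UN'[OF countable_bad_section[OF n F w r]]) (auto intro!: null_setsI simp: \<mu>)
    ultimately show "{x. ?bad (X(n := x))} \<in> null_sets \<mu>" by simp
  qed auto
  then have "AE X in ?M'. AE x in \<mu>. \<not> ?bad (X(n := x))" by simp
  \<comment> \<open>Sections are null for each fixed \<open>X\<close>, whereas the criterion for the
    pair measure has \<open>x\<close> outermost; measurability permits the exchange.\<close>
  then have "AE x in \<mu>. AE X in ?M'. \<not> ?bad (X(n := x))"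
    using meas' by (subst AE_commute) (auto simp: case_prod_unfold)
  then have "AE z in \<mu> \<Otimes>\<^sub>M ?M'. \<not> ?bad (?up z)"
    using meas' by (intro AE_pair_measure) auto
  then have "AE \<omega> in distr (\<mu> \<Otimes>\<^sub>M ?M') ?M ?up. \<not> ?bad \<omega>"
    by (subst AE_distr_iff[OF up meas])
  then show ?thesis unfolding distr .
qed

text \<open>After scaling \<open>f\<close> to norm \<open>1\<close> and \<open>g\<close> to the
  value \<open>1\<close> at \<open>n\<close>, the strict inequality reads \<open>c * b < w2\<close>.
  Its slack is shared out over rationals: \<open>s\<close> below \<open>1\<close>, then
  \<open>t\<close> above \<open>b\<close>, then \<open>r\<close> between \<open>c * t\<close> and
  \<open>w2 * s\<close>.\<close>

lemma strict_imp_bad: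
  assumes n: "n \<in> L" and w: "0 < w1" "0 < w2" and f: "sol w1 \<omega> E f" and g: "sol w2 \<omega> E g"
    and strict: "w1 * (f n)\<^sup>2 * inner_on L g g < w2 * (g n)\<^sup>2 * inner_on L f f"
  shows "\<exists>F s t r R. finite F \<and> F \<subseteq> L \<and> s \<in> \<rat> \<and> t \<in> \<rat> \<and> r \<in> \<rat> \<and> R \<in> \<rat> \<and> r < w2 * s \<and>
    bad w1 w2 n F s t r R \<omega>"
proof -
  let ?a = "inner_on L f f" and ?b = "inner_on L g g"
  have "0 \<le> w1 * (f n)\<^sup>2 * ?b"
    using w inner_on_self_nonneg by (intro mult_nonneg_nonneg) auto
  with strict have pos: "0 < w2 * (g n)\<^sup>2 * ?a" by linarith
  have gn: "g n \<noteq> 0" using pos by auto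
  have a: "0 < ?a" using pos inner_on_self_nonneg[of L f] by (cases "?a = 0") auto
  define f1 where "f1 v = inverse (sqrt ?a) * f v" for v
  define g1 where "g1 v = inverse (g n) * g v" for v
  have f1: "sol w1 \<omega> E f1" and g1: "sol w2 \<omega> E g1"
    unfolding f1_def g1_def using f g by (auto intro: sol_cmult)
  have f1f1: "inner_on L f1 f1 = 1"
    unfolding f1_def inner_on_cmult_self using a by (simp add: power_inverse)
  have g1n: "g1 n = 1" using gn by (simp add: g1_def)
  define b where "b = inner_on L g1 g1"
  define c where "c = w1 * (f1 n)\<^sup>2"
  have b: "b = ?b / (g n)\<^sup>2"
    unfolding b_def g1_def inner_on_cmult_self by (simp add: field_simps)
  have c: "c = w1 * (f n)\<^sup>2 / ?a"
    unfolding c_def f1_def using a by (simp add: power_mult_distrib power_inverse field_simps)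
  have c0: "0 \<le> c" unfolding c_def using w by simp
  have cb: "c * b < w2"
    unfolding b c using strict a gn by (simp add: field_simps)
  then have "c * b / w2 < 1" using w by simp
  then obtain s where s: "s \<in> \<rat>" "c * b / w2 < s" "s < 1" using Rats_dense_in_real by blast
  have cbs: "c * b < w2 * s" using s(2) w by (simp add: field_simps)
  \<comment> \<open>The upper limit for \<open>t\<close> forces
    \<open>c * (t - b) < w2 * s - c * b\<close>; dividing by \<open>c + 1\<close> also covers
    \<open>c = 0\<close>.\<close>
  have "b < b + (w2 * s - c * b) / (c + 1)" using cbs c0 by simp
  then obtain t where t: "t \<in> \<rat>" "b < t" "t < b + (w2 * s - c * b) / (c + 1)"
    using Rats_dense_in_real by blast
  have "c * t < w2 * s"
  proof -
    have "(t - b) * (c + 1) < w2 * s - c * b"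
      using t(3) c0 by (simp add: field_simps)
    moreover have "0 < t - b" using t(2) by simp
    ultimately show ?thesis by (simp add: algebra_simps)
  qed
  then obtain r where r: "r \<in> \<rat>" "c * t < r" "r < w2 * s" using Rats_dense_in_real by blast
  obtain R where R: "R \<in> \<rat>" "\<bar>E\<bar> < R" "R < \<bar>E\<bar> + 1"
    using Rats_dense_in_real[of "\<bar>E\<bar>" "\<bar>E\<bar> + 1"] by auto
  have "(\<lambda>v. (f1 v)\<^sup>2) summable_on L" using sol_ell2[OF f1] by (simp add: ell2_def)
  \<comment> \<open>Since \<open>f1\<close> has norm \<open>1\<close>, a partial sum within
    \<open>1 - s\<close> of the full sum is at least \<open>s\<close>.\<close>
  then obtain F where F: "finite F" "F \<subseteq> L" "dist (\<Sum>v\<in>F. (f1 v)\<^sup>2) (\<Sum>\<^sub>\<infinity>v\<in>L. (f1 v)\<^sup>2) \<le> 1 - s"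
    using infsum_finite_approximation[of "\<lambda>v. (f1 v)\<^sup>2" L "1 - s"] s(3) by auto
  have "s \<le> (\<Sum>v\<in>F. (f1 v)\<^sup>2)"
    using F(3) f1f1 unfolding inner_on_self dist_real_def by linarith
  then have "witness w1 w2 n F s t r R \<omega> E f1 g1"
    unfolding witness_def using f1 g1 f1f1 g1n R r(2) t(2)
    by (simp add: b_def[symmetric] c_def[symmetric])
  then show ?thesis
    using F s t r R unfolding bad_def by blast
qed

text \<open>One null set serves all \<open>E\<close>, \<open>f\<close>, \<open>g\<close>: by
  \<open>strict_imp_bad\<close> every violation is caught by one of countably many parameter tuples,
  made of finite subsets of \<open>L\<close> and rationals.\<close>

lemma AE_weights_le:
  assumes n: "n \<in> L" and w: "0 < w1" "0 < w2"
    and \<mu>: "prob_space \<mu>" "sets \<mu> = sets borel" "\<And>x. emeasure \<mu> {x} = 0"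
  shows "AE \<omega> in PiM L (\<lambda>_. \<mu>). \<forall>E f g. sol w1 \<omega> E f \<and> sol w2 \<omega> E g \<longrightarrow>
    w2 * (g n)\<^sup>2 * inner_on L f f \<le> w1 * (f n)\<^sup>2 * inner_on L g g"
proof -
  define P where "P = {(F, s :: real, t :: real, r :: real, R :: real). finite F \<and> F \<subseteq> L \<and> s \<in> \<rat> \<and> t \<in> \<rat> \<and> r \<in> \<rat> \<and> R \<in> \<rat> \<and> r < w2 * s}"
  have "countable ({F. finite F \<and> F \<subseteq> L} \<times> (\<rat> :: real set) \<times> (\<rat> :: real set) \<times> (\<rat> :: real set) \<times> (\<rat> :: real set))"
    using countable_L by (intro countable_SIGMA countable_rat countable_Collect_finite_subset)
  then have "countable P"
    by (rule countable_subset[rotated]) (auto simp: P_def)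
  moreover have "AE \<omega> in PiM L (\<lambda>_. \<mu>). case p of (F, s, t, r, R) \<Rightarrow> \<not> bad w1 w2 n F s t r R \<omega>" if "p \<in> P" for p
    using that AE_not_bad[OF n _ _ w _ \<mu>] by (auto simp: P_def)
  ultimately have "AE \<omega> in PiM L (\<lambda>_. \<mu>). \<forall>p\<in>P. case p of (F, s, t, r, R) \<Rightarrow> \<not> bad w1 w2 n F s t r R \<omega>"
    by (simp add: AE_ball_countable)
  then show ?thesis
  proof (rule AE_mp, intro AE_I2 impI allI)
    fix \<omega> E f g
    assume P: "\<forall>p\<in>P. case p of (F, s, t, r, R) \<Rightarrow> \<not> bad w1 w2 n F s t r R \<omega>"
      and "sol w1 \<omega> E f \<and> sol w2 \<omega> E g"
    then have fg: "sol w1 \<omega> E f" "sol w2 \<omega> E g" by auto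
    show "w2 * (g n)\<^sup>2 * inner_on L f f \<le> w1 * (f n)\<^sup>2 * inner_on L g g"
    proof (rule ccontr)
      assume "\<not> ?thesis"
      then obtain F s t r R where F: "(F, s, t, r, R) \<in> P" "bad w1 w2 n F s t r R \<omega>"
        using strict_imp_bad[OF n w fg] unfolding P_def by auto
      from P F(1) have "case (F, s, t, r, R) of (F, s, t, r, R) \<Rightarrow> \<not> bad w1 w2 n F s t r R \<omega>" by (rule bspec)
      with F(2) show False by simp
    qed
  qed
qed

section \<open>Consequences of the balance inequality for scalar solutions\<close>

definition balanced :: "real set \<Rightarrow> ('a \<Rightarrow> real) \<Rightarrow> bool" where
  "balanced S \<omega> \<longleftrightarrow> (\<forall>w1\<in>S. \<forall>w2\<in>S. \<forall>n\<in>L. \<forall>E f g. sol w1 \<omega> E f \<and> sol w2 \<omega> E g \<longrightarrow>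
    w2 * (g n)\<^sup>2 * inner_on L f f \<le> w1 * (f n)\<^sup>2 * inner_on L g g)"

lemma AE_balanced:
  assumes "countable S" "\<And>w. w \<in> S \<Longrightarrow> 0 < w"
    and "prob_space \<mu>" "sets \<mu> = sets borel" "\<And>x. emeasure \<mu> {x} = 0"
  shows "AE \<omega> in PiM L (\<lambda>_. \<mu>). balanced S \<omega>"
  unfolding balanced_def
  using assms(1) countable_L AE_weights_le[OF _ assms(2,2) assms(3-5)]
  by (simp add: AE_ball_countable)

text \<open>The reverse inequality comes from exchanging the two weights and the two
  solutions.\<close>

lemma balanced_eq:
  assumes "balanced S \<omega>" "w1 \<in> S" "w2 \<in> S" "n \<in> L" "sol w1 \<omega> E f" "sol w2 \<omega> E g"
  shows "w2 * (g n)\<^sup>2 * inner_on L f f = w1 * (f n)\<^sup>2 * inner_on L g g"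
  using assms unfolding balanced_def by (intro antisym) blast+

text \<open>Summing the balance over all sites turns it into equality of \<open>w2\<close> and
  \<open>w1\<close> times the same product of squared norms, which is positive if neither function
  vanishes.\<close>

lemma balanced_distinct_weights:
  assumes bal: "balanced S \<omega>" and w: "w1 \<in> S" "w2 \<in> S" "w1 \<noteq> w2"
    and f: "sol w1 \<omega> E f" and g: "sol w2 \<omega> E g" and u: "u \<in> L" "f u \<noteq> 0" and v: "v \<in> L"
  shows "g v = 0"
proof (rule ccontr)
  assume "g v \<noteq> 0"
  let ?a = "inner_on L f f" and ?b = "inner_on L g g"
  have pos: "0 < ?a" "0 < ?b"
    using inner_on_self_pos[OF sol_ell2[OF f] u] inner_on_self_pos[OF sol_ell2[OF g] v \<open>g v \<noteq> 0\<close>] .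
  have "(\<Sum>\<^sub>\<infinity>n\<in>L. (w2 * ?a) * (g n)\<^sup>2) = (\<Sum>\<^sub>\<infinity>n\<in>L. (w1 * ?b) * (f n)\<^sup>2)"
    by (rule infsum_cong) (use balanced_eq[OF bal w(1,2) _ f g] in \<open>simp add: ac_simps\<close>)
  then have "w2 * ?a * ?b = w1 * ?b * ?a"
    unfolding infsum_cmult_right' inner_on_self .
  then show False using pos w(3) by simp
qed

text \<open>Subtracting a multiple of \<open>f\<close> produces a solution \<open>h\<close> with
  \<open>h u = 0\<close>. Balance of \<open>h\<close> against \<open>f\<close> at \<open>u\<close>,
  where \<open>f\<close> is nonzero, forces \<open>h\<close> to have norm zero.\<close>

lemma balanced_same_weight:
  assumes bal: "balanced S \<omega>" and w: "w \<in> S" "0 < w"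
    and f: "sol w \<omega> E f" and g: "sol w \<omega> E g" and u: "u \<in> L" "f u \<noteq> 0"
  shows "\<exists>c. \<forall>v\<in>L. g v = c * f v"
proof -
  define h where "h v = g v - g u / f u * f v" for v
  have h: "sol w \<omega> E h"
    using sol_lincomb[OF g f, of 1 "- (g u / f u)"] unfolding h_def by simp
  have hu: "h u = 0" using u by (simp add: h_def)
  have "w * (f u)\<^sup>2 * inner_on L h h = 0"
    using balanced_eq[OF bal w(1,1) u(1) h f] hu by simp
  then have "inner_on L h h = 0" using w u by simp
  then have "h v = 0" if "v \<in> L" for v
    using inner_on_self_pos[OF sol_ell2[OF h] that] by (metis less_irrefl)
  then show ?thesis unfolding h_def by (intro exI[of _ "g u / f u"]) auto
qed

text \<open>Here \<open>f + i g\<close> is an eigenfunction with energy \<open>a + i b\<close>.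
  Symmetry makes the imaginary part of its pairing with its image vanish, and this part is
  \<open>b\<close> times its squared norm.\<close>

lemma complex_energy_zero:
  assumes f: "ell2 L f" and g: "ell2 L g" and b: "b \<noteq> 0"
    and eqf: "\<And>v. v \<in> L \<Longrightarrow> adj f v + w * \<omega> v * f v = a * f v - b * g v"
    and eqg: "\<And>v. v \<in> L \<Longrightarrow> adj g v + w * \<omega> v * g v = a * g v + b * f v"
    and v: "v \<in> L"
  shows "f v = 0 \<and> g v = 0"
proof -
  have "f v * adj g v - g v * adj f v = b * ((f v)\<^sup>2 + (g v)\<^sup>2)" if "v \<in> L" for v
  proof -
    have *: "adj f v = a * f v - b * g v - w * \<omega> v * f v" "adj g v = a * g v + b * f v - w * \<omega> v * g v"
      using eqf[OF that] eqg[OF that] by linarith+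
    show ?thesis unfolding * by (simp add: algebra_simps power2_eq_square)
  qed
  then have "(\<Sum>\<^sub>\<infinity>v\<in>L. f v * adj g v - g v * adj f v) = (\<Sum>\<^sub>\<infinity>v\<in>L. b * ((f v)\<^sup>2 + (g v)\<^sup>2))"
    by (rule infsum_cong)
  also have "\<dots> = b * (inner_on L f f + inner_on L g g)"
    unfolding infsum_cmult_right' inner_on_self
    using f g by (subst infsum_add) (auto simp: ell2_def)
  also have "(\<Sum>\<^sub>\<infinity>v\<in>L. f v * adj g v - g v * adj f v) = 0"
    using adj_symmetric[OF f g] adj_summable[OF f g] adj_summable[OF g f]
    by (subst infsum_diff_real) auto
  finally have "inner_on L f f + inner_on L g g = 0" using b by simp
  then have "inner_on L f f = 0" "inner_on L g g = 0"
    using inner_on_self_nonneg[of L f] inner_on_self_nonneg[of L g] by linarith+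
  then show ?thesis
    using inner_on_self_pos[OF f v] inner_on_self_pos[OF g v] by (metis less_irrefl)
qed

end

section \<open>The integer lattice and the decoupling by eigenvectors\<close>

lemma countable_lattice: "countable (lattice d)"
proof -
  have "inj_on (\<lambda>n. map n [0..<d]) (lattice d)"
  proof (rule inj_onI, rule ext)
    fix m n i assume "m \<in> lattice d" "n \<in> lattice d" "map m [0..<d] = map n [0..<d]"
    then show "m i = n i" by (cases "i < d") (auto simp: lattice_def)
  qed
  then show ?thesis
    by (rule countable_image_inj_on[rotated]) simp
qed

lemma finite_nbr_origin: "finite {m \<in> lattice d. nbr d m (\<lambda>_. 0)}"
proof (rule finite_subset)
  show "{m \<in> lattice d. nbr d m (\<lambda>_. 0)}
      \<subseteq> {m. \<forall>i. (i \<in> {..<d} \<longrightarrow> m i \<in> {-1..1}) \<and> (i \<notin> {..<d} \<longrightarrow> m i = 0)}"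
  proof clarsimp
    fix m i assume m: "m \<in> lattice d" "nbr d m (\<lambda>_. 0)"
    have "\<bar>m i\<bar> \<le> 1" if "i < d"
      using member_le_sum[of i "{..<d}" "\<lambda>i. \<bar>m i\<bar>"] that m(2) by (simp add: nbr_def)
    then show "(i < d \<longrightarrow> - 1 \<le> m i \<and> m i \<le> 1) \<and> (\<not> i < d \<longrightarrow> m i = 0)"
      using m(1) by (auto simp: lattice_def abs_le_iff)
  qed
  show "finite {m. \<forall>i. (i \<in> {..<d} \<longrightarrow> m i \<in> {-1..1::int}) \<and> (i \<notin> {..<d} \<longrightarrow> m i = 0)}"
    by (rule finite_set_of_finite_funs) auto
qed

text \<open>Translation invariance makes the degree at the origin a bound for the degree
  everywhere.\<close>

lemma nbr_subset_translate:
  assumes "n \<in> lattice d"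
  shows "{m \<in> lattice d. nbr d m n} \<subseteq> (\<lambda>k i. k i + n i) ` {m \<in> lattice d. nbr d m (\<lambda>_. 0)}"
proof
  fix m assume m: "m \<in> {m \<in> lattice d. nbr d m n}"
  have "(\<lambda>i. m i - n i) \<in> {m \<in> lattice d. nbr d m (\<lambda>_. 0)}"
    using m assms by (auto simp: lattice_def nbr_def)
  then show "m \<in> (\<lambda>k i. k i + n i) ` {m \<in> lattice d. nbr d m (\<lambda>_. 0)}"
    by (rule image_eqI[rotated]) simp
qed

lemma lattice_bounded_degree_graph:
  "bounded_degree_graph (lattice d) (\<lambda>n. {m \<in> lattice d. nbr d m n})
     (card {m \<in> lattice d. nbr d m (\<lambda>_. 0)})"
proof
  show "countable (lattice d)" by (rule countable_lattice)
  show "lattice d \<noteq> {}" by (auto simp: lattice_def intro: exI[of _ "\<lambda>_. 0"])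
  fix v assume v: "v \<in> lattice d"
  show "{m \<in> lattice d. nbr d m v} \<subseteq> lattice d" by auto
  show "finite {m \<in> lattice d. nbr d m v}"
    using nbr_subset_translate[OF v] finite_nbr_origin by (meson finite_imageI finite_subset)
  show "card {m \<in> lattice d. nbr d m v} \<le> card {m \<in> lattice d. nbr d m (\<lambda>_. 0)}"
    using card_mono[OF finite_imageI[OF finite_nbr_origin] nbr_subset_translate[OF v]]
      card_image_le[OF finite_nbr_origin] by (rule order_trans)
  fix u assume "u \<in> lattice d"
  with v show "u \<in> {m \<in> lattice d. nbr d m v} \<longleftrightarrow> v \<in> {m \<in> lattice d. nbr d m u}"
    by (simp add: nbr_def abs_minus_commute)
qed

section \<open>Eigenvectors of the matrix; real and imaginary parts of complex vectors\<close>

lemma inner_symmetric_matrix: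
  fixes W :: "real^'k^'k"
  assumes "transpose W = W"
  shows "x \<bullet> (W *v y) = (W *v x) \<bullet> y"
  using assms by (metis dot_lmul_matrix transpose_matrix_vector)

text \<open>Eigenvectors for distinct eigenvalues are orthogonal. A nonzero \<open>x\<close>
  orthogonal to all of them would give more nonzero orthogonal vectors than the dimension
  allows.\<close>

lemma simple_spectrum_eigenvectors_separate:
  fixes W :: "real^'k^'k" and u :: "real \<Rightarrow> real^'k"
  assumes sym: "transpose W = W"
    and card: "card S = CARD('k)"
    and u: "\<And>e. e \<in> S \<Longrightarrow> u e \<noteq> 0 \<and> W *v u e = e *\<^sub>R u e"
    and x: "\<And>e. e \<in> S \<Longrightarrow> u e \<bullet> x = 0"
  shows "x = 0"
proof (rule ccontr)
  assume "x \<noteq> 0"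
  have orth: "u e \<bullet> u e' = 0" if "e \<in> S" "e' \<in> S" "e \<noteq> e'" for e e'
  proof -
    have "e' * (u e \<bullet> u e') = e * (u e \<bullet> u e')"
      using inner_symmetric_matrix[OF sym, of "u e" "u e'"] u that by simp
    then show ?thesis using that by simp
  qed
  have inj: "inj_on u S"
  proof (rule inj_onI, rule ccontr)
    fix e e' assume "e \<in> S" "e' \<in> S" "u e = u e'" "e \<noteq> e'"
    then show False using orth[of e e'] u[of e'] by simp
  qed
  have "x \<notin> u ` S" using x \<open>x \<noteq> 0\<close> by force
  moreover have "finite S" using card by (metis card.infinite zero_less_card_finite less_irrefl)
  ultimately have "card (insert x (u ` S)) = Suc CARD('k)"
    using card_image[OF inj] card by simp
  moreover have "pairwise orthogonal (insert x (u ` S))"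
    unfolding pairwise_insert orthogonal_def
    using x orth by (auto simp: pairwise_def orthogonal_def inner_commute)
  then have "independent (insert x (u ` S))"
    by (rule pairwise_orthogonal_independent) (use u \<open>x \<noteq> 0\<close> in force)
  then have "card (insert x (u ` S)) \<le> CARD('k)"
    using independent_bound by fastforce
  ultimately show False by simp
qed

definition re_vec :: "complex^'k \<Rightarrow> real^'k" where "re_vec z = (\<chi> i. Re (z $ i))"
definition im_vec :: "complex^'k \<Rightarrow> real^'k" where "im_vec z = (\<chi> i. Im (z $ i))"

lemma re_im_vec_eqI: "re_vec z = re_vec z' \<Longrightarrow> im_vec z = im_vec z' \<Longrightarrow> z = z'"
  by (simp add: re_vec_def im_vec_def vec_eq_iff complex_eq_iff)

lemma re_im_vec_add:
  "re_vec (z + z') = re_vec z + re_vec z'" "im_vec (z + z') = im_vec z + im_vec z'"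
  by (simp_all add: re_vec_def im_vec_def vec_eq_iff)

lemma re_im_vec_zero: "re_vec 0 = 0" "im_vec 0 = 0"
  by (simp_all add: re_vec_def im_vec_def vec_eq_iff)

lemma re_im_vec_sum:
  "re_vec (\<Sum>m\<in>A. z m) = (\<Sum>m\<in>A. re_vec (z m))" "im_vec (\<Sum>m\<in>A. z m) = (\<Sum>m\<in>A. im_vec (z m))"
  by (simp_all add: re_vec_def im_vec_def vec_eq_iff sum_component)

lemma re_im_vec_scale:
  "re_vec (c *s z) = Re c *\<^sub>R re_vec z - Im c *\<^sub>R im_vec z"
  "im_vec (c *s z) = Re c *\<^sub>R im_vec z + Im c *\<^sub>R re_vec z"
  by (simp_all add: re_vec_def im_vec_def vec_eq_iff)

lemma re_im_vec_cmat_vec: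
  "re_vec (cmat_vec W z) = W *v re_vec z" "im_vec (cmat_vec W z) = W *v im_vec z"
  by (simp_all add: re_vec_def im_vec_def vec_eq_iff cmat_vec_def matrix_vector_mult_def)

lemma norm_re_im_vec_le: "norm (re_vec z) \<le> norm z" "norm (im_vec z) \<le> norm z"
  unfolding norm_vec_def re_vec_def im_vec_def
  by (auto intro!: L2_set_mono abs_Re_le_cmod abs_Im_le_cmod)

text \<open>To be applied with \<open>re_vec\<close> and \<open>im_vec\<close> as \<open>p\<close>;
  Cauchy-Schwarz bounds the component by a multiple of the norm.\<close>

lemma ell2_component:
  assumes "\<phi> \<in> l2 d" and le: "\<And>z. norm (p z) \<le> norm z"
  shows "ell2 (lattice d) (\<lambda>n. u \<bullet> p (\<phi> n))"
proof -
  have "(\<lambda>n. (norm u)\<^sup>2 * (norm (\<phi> n))\<^sup>2) summable_on lattice d"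
    using assms(1) unfolding l2_def by (intro summable_on_cmult_right) simp
  then show ?thesis
    unfolding ell2_def
  proof (rule summable_on_comparison_test)
    fix n
    have "\<bar>u \<bullet> p (\<phi> n)\<bar> \<le> norm u * norm (p (\<phi> n))" by (rule Cauchy_Schwarz_ineq2)
    also have "\<dots> \<le> norm u * norm (\<phi> n)" using le by (rule mult_left_mono) simp
    finally have "\<bar>u \<bullet> p (\<phi> n)\<bar>\<^sup>2 \<le> (norm u * norm (\<phi> n))\<^sup>2" by (rule power_mono) simp
    then show "(u \<bullet> p (\<phi> n))\<^sup>2 \<le> (norm u)\<^sup>2 * (norm (\<phi> n))\<^sup>2"
      by (simp add: power_mult_distrib)
  qed simp
qed

section \<open>From the scalar components back to the vector-valued operator\<close>

theorem theorem1p2: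
  fixes d :: nat and W :: "real^'k^'k" and \<rho> :: "real \<Rightarrow> real" and \<mu> :: "real measure"
  assumes sym: "transpose W = W"
    and posdef: "\<forall>x. x \<noteq> 0 \<longrightarrow> x \<bullet> (W *v x) > 0"
    and simple_spec: "card {e. \<exists>v. v \<noteq> 0 \<and> W *v v = e *\<^sub>R v} = CARD('k)"
    and \<rho>_meas: "\<rho> \<in> borel_measurable borel"
    and \<rho>_nonneg: "\<forall>x. \<rho> x \<ge> 0"
    and \<rho>_bdd: "\<exists>B. \<forall>x. \<rho> x \<le> B"
    and \<rho>_cpt: "\<exists>K. compact K \<and> (\<forall>x. x \<notin> K \<longrightarrow> \<rho> x = 0)"
    and \<mu>_def: "\<mu> = density lborel (\<lambda>x. ennreal (\<rho> x))"
    and \<mu>_prob: "prob_space \<mu>"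
  shows "AE \<omega> in PiM (lattice d) (\<lambda>_. \<mu>).
           \<forall>E. is_eigenvalue d W \<omega> E \<longrightarrow> simple_eigenvalue d W \<omega> E"
proof -
  interpret bounded_degree_graph "lattice d" "\<lambda>n. {m \<in> lattice d. nbr d m n}"
    "card {m \<in> lattice d. nbr d m (\<lambda>_. 0)}"
    by (rule lattice_bounded_degree_graph)
  define S where "S = {e. \<exists>v. v \<noteq> 0 \<and> W *v v = e *\<^sub>R v}"
  have card_S: "card S = CARD('k)" unfolding S_def by (rule simple_spec)
  then have "finite S" by (metis card.infinite zero_less_card_finite less_irrefl)
  have "\<forall>e\<in>S. \<exists>v. v \<noteq> 0 \<and> W *v v = e *\<^sub>R v" by (simp add: S_def)
  then obtain u where u: "\<And>e. e \<in> S \<Longrightarrow> u e \<noteq> 0 \<and> W *v u e = e *\<^sub>R u e"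
    by (metis (no_types, lifting) bchoice)
  have separate: "x = 0" if "\<And>e. e \<in> S \<Longrightarrow> u e \<bullet> x = 0" for x
    using simple_spectrum_eigenvectors_separate[OF sym card_S u that] by blast
  have S_pos: "0 < e" if "e \<in> S" for e
  proof -
    have "0 < u e \<bullet> (W *v u e)" using posdef u[OF that] by blast
    then have "0 < e * (u e \<bullet> u e)" using u[OF that] by simp
    then show ?thesis by (metis inner_ge_zero zero_less_mult_pos2 mult_pos_pos not_less
      mult_nonpos_nonneg)
  qed
  have sets_\<mu>: "sets \<mu> = sets borel" unfolding \<mu>_def by simp
  have atomless: "emeasure \<mu> {x} = 0" for x
  proof -
    have "AE y in lborel. y \<in> {x} \<longrightarrow> ennreal (\<rho> y) = 0"
      using AE_lborel_singleton[of x] by eventually_elim simp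
    then have "{x} \<in> null_sets \<mu>"
      unfolding \<mu>_def using \<rho>_meas by (subst null_sets_density_iff) auto
    then show ?thesis by (simp add: null_setsD1)
  qed
  have "AE \<omega> in PiM (lattice d) (\<lambda>_. \<mu>). balanced S \<omega>"
    using \<open>finite S\<close> S_pos \<mu>_prob sets_\<mu> atomless by (intro AE_balanced) (auto intro: countable_finite)
  then show ?thesis
  proof (rule AE_mp, intro AE_I2 impI allI)
    fix \<omega> E assume bal: "balanced S \<omega>"
    define A where "A e \<phi> n = u e \<bullet> re_vec (\<phi> n)" for e and \<phi> :: "(nat \<Rightarrow> int) \<Rightarrow> complex^'k" and n
    define B where "B e \<phi> n = u e \<bullet> im_vec (\<phi> n)" for e and \<phi> :: "(nat \<Rightarrow> int) \<Rightarrow> complex^'k" and n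
    have ell2: "ell2 (lattice d) (A e \<phi>)" "ell2 (lattice d) (B e \<phi>)" if "eigvec d W \<omega> E \<phi>" for e \<phi>
      using that ell2_component[of \<phi> d] norm_re_im_vec_le unfolding A_def B_def eigvec_def by blast+
    \<comment> \<open>Pairing the eigenvalue equation with \<open>u e\<close> replaces
      \<open>W\<close> by the number \<open>e\<close>; the real and imaginary components remain
      coupled only through \<open>Im E\<close>.\<close>
    have eqA: "adj (A e \<phi>) n + e * \<omega> n * A e \<phi> n = Re E * A e \<phi> n - Im E * B e \<phi> n"
      and eqB: "adj (B e \<phi>) n + e * \<omega> n * B e \<phi> n = Re E * B e \<phi> n + Im E * A e \<phi> n"
      if "eigvec d W \<omega> E \<phi>" "e \<in> S" "n \<in> lattice d" for e \<phi> n
    proof -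
      have *: "(\<Sum>m\<in>{m \<in> lattice d. nbr d m n}. \<phi> m) + complex_of_real (\<omega> n) *s cmat_vec W (\<phi> n) = E *s \<phi> n"
        using that unfolding eigvec_def H_A_def by blast
      have W: "u e \<bullet> (W *v x) = e * (u e \<bullet> x)" for x
        using inner_symmetric_matrix[OF sym, of "u e" x] u[OF that(2)] by simp
      show "adj (A e \<phi>) n + e * \<omega> n * A e \<phi> n = Re E * A e \<phi> n - Im E * B e \<phi> n"
        using arg_cong[OF *, of "\<lambda>z. u e \<bullet> re_vec z"]
        unfolding adj_def A_def B_def
        by (simp add: re_im_vec_add re_im_vec_sum re_im_vec_scale re_im_vec_cmat_vec W
            inner_add_right inner_diff_right inner_sum_right mult.commute mult.left_commute)
      show "adj (B e \<phi>) n + e * \<omega> n * B e \<phi> n = Re E * B e \<phi> n + Im E * A e \<phi> n"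
        using arg_cong[OF *, of "\<lambda>z. u e \<bullet> im_vec z"]
        unfolding adj_def A_def B_def
        by (simp add: re_im_vec_add re_im_vec_sum re_im_vec_scale re_im_vec_cmat_vec W
            inner_add_right inner_diff_right inner_sum_right mult.commute mult.left_commute)
    qed
    have nonzero: "\<exists>e\<in>S. A e \<phi> n \<noteq> 0 \<or> B e \<phi> n \<noteq> 0" if "\<phi> n \<noteq> 0" for \<phi> n
    proof (rule ccontr)
      assume "\<not> ?thesis"
      then have "re_vec (\<phi> n) = 0" "im_vec (\<phi> n) = 0"
        by (auto intro!: separate simp: A_def B_def)
      then have "\<phi> n = 0" by (intro re_im_vec_eqI) (simp_all add: re_im_vec_zero)
      with that show False ..
    qed
    show "simple_eigenvalue d W \<omega> E"
      unfolding simple_eigenvalue_def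
    proof (intro allI impI)
      fix \<phi> \<psi> assume "eigvec d W \<omega> E \<phi> \<and> eigvec d W \<omega> E \<psi>"
      then have \<phi>: "eigvec d W \<omega> E \<phi>" and \<psi>: "eigvec d W \<omega> E \<psi>" by auto
      obtain n0 where n0: "n0 \<in> lattice d" "\<phi> n0 \<noteq> 0" using \<phi> unfolding eigvec_def by blast
      obtain e0 where e0: "e0 \<in> S" "A e0 \<phi> n0 \<noteq> 0 \<or> B e0 \<phi> n0 \<noteq> 0" using nonzero[of \<phi> n0] n0(2) by blast
      have "Im E = 0"
      proof (rule ccontr)
        assume "Im E \<noteq> 0"
        then have "A e0 \<phi> n0 = 0 \<and> B e0 \<phi> n0 = 0"
          using complex_energy_zero[OF ell2[OF \<phi>] _ eqA[OF \<phi> e0(1)] eqB[OF \<phi> e0(1)] n0(1)] by blast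
        with e0(2) show False by blast
      qed
      then have sol: "sol e \<omega> (Re E) (A e \<xi>)" "sol e \<omega> (Re E) (B e \<xi>)" if "eigvec d W \<omega> E \<xi>" "e \<in> S" for e \<xi>
        using ell2[OF that(1)] eqA[OF that] eqB[OF that] by (simp_all add: sol_def)
      \<comment> \<open>Whichever of the two real components is nonzero at \<open>n0\<close> serves
        as reference solution; all components of both eigenvectors are compared with
        \<open>h\<close>.\<close>
      obtain h where h: "sol e0 \<omega> (Re E) h" "h n0 \<noteq> 0" using e0 sol[OF \<phi> e0(1)] by blast
      \<comment> \<open>As \<open>e0\<close> already has the energy \<open>Re E\<close>, no other
        weight can share it, so only the component along \<open>u e0\<close> survives.\<close>
      have other: "A e \<xi> n = 0 \<and> B e \<xi> n = 0"
        if "eigvec d W \<omega> E \<xi>" "e \<in> S" "e \<noteq> e0" "n \<in> lattice d" for e \<xi> n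
        using balanced_distinct_weights[OF bal e0(1) that(2) that(3)[symmetric] h(1) _ n0(1) h(2) that(4)]
          sol[OF that(1,2)] by blast
      have same: "\<exists>c. \<forall>n\<in>lattice d. f n = c * h n" if "sol e0 \<omega> (Re E) f" for f
        by (rule balanced_same_weight[OF bal e0(1) S_pos[OF e0(1)] h(1) that n0(1) h(2)])
      obtain a where a: "\<forall>n\<in>lattice d. A e0 \<phi> n = a * h n" using same[OF sol(1)[OF \<phi> e0(1)]] by blast
      obtain b where b: "\<forall>n\<in>lattice d. B e0 \<phi> n = b * h n" using same[OF sol(2)[OF \<phi> e0(1)]] by blast
      obtain a' where a': "\<forall>n\<in>lattice d. A e0 \<psi> n = a' * h n" using same[OF sol(1)[OF \<psi> e0(1)]] by blast
      obtain b' where b': "\<forall>n\<in>lattice d. B e0 \<psi> n = b' * h n" using same[OF sol(2)[OF \<psi> e0(1)]] by blast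
      have "Complex a b \<noteq> 0" using e0(2) a b n0(1) by (auto simp: complex_eq_iff)
      \<comment> \<open>Along \<open>u e0\<close>, \<open>\<phi>\<close> is
        \<open>Complex a b\<close> times \<open>h\<close> and \<open>\<psi>\<close> is
        \<open>Complex a' b'\<close> times \<open>h\<close>, so the quotient is the required
        factor.\<close>
      define c where "c = Complex a' b' / Complex a b"
      have "c * Complex a b = Complex a' b'" using \<open>Complex a b \<noteq> 0\<close> by (simp add: c_def)
      then have c: "Re c * a - Im c * b = a'" "Re c * b + Im c * a = b'"
        by (simp_all add: complex_eq_iff)
      have "\<psi> n = c *s \<phi> n" if n: "n \<in> lattice d" for n
      proof (rule re_im_vec_eqI)
        have "u e \<bullet> (re_vec (\<psi> n) - re_vec (c *s \<phi> n)) = 0 \<and> u e \<bullet> (im_vec (\<psi> n) - im_vec (c *s \<phi> n)) = 0"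
          if "e \<in> S" for e
        proof -
          have "A e \<psi> n = Re c * A e \<phi> n - Im c * B e \<phi> n" "B e \<psi> n = Re c * B e \<phi> n + Im c * A e \<phi> n"
          proof -
            show "A e \<psi> n = Re c * A e \<phi> n - Im c * B e \<phi> n"
              using other[OF \<phi> that _ n] other[OF \<psi> that _ n] a b a' n c(1)[symmetric]
              by (cases "e = e0") (auto simp: algebra_simps)
            show "B e \<psi> n = Re c * B e \<phi> n + Im c * A e \<phi> n"
              using other[OF \<phi> that _ n] other[OF \<psi> that _ n] a b b' n c(2)[symmetric]
              by (cases "e = e0") (auto simp: algebra_simps)
          qed
          then show ?thesis
            by (simp add: A_def B_def re_im_vec_scale inner_diff_right inner_add_right)
        qed
        then have "re_vec (\<psi> n) - re_vec (c *s \<phi> n) = 0" "im_vec (\<psi> n) - im_vec (c *s \<phi> n) = 0"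
          using separate by blast+
        then show "re_vec (\<psi> n) = re_vec (c *s \<phi> n)" "im_vec (\<psi> n) = im_vec (c *s \<phi> n)" by simp_all
      qed
      then show "\<exists>c. \<forall>n\<in>lattice d. \<psi> n = c *s \<phi> n" by blast
    qed
  qed
qed

end
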